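(* Let $\varphi_0,\varphi_1\in\mathcal G$ with $\mathrm{char}(\varphi_0)=\mathrm{char}(\varphi_1)=:c_0\ge1$ and write $\varphi_0=c_0s+\psi_0$, $\varphi_1=c_0s+\psi_1$. Assume that there exists $C>0$ such that, on $\mathbb C_+$, \begin{itemize} \item $|\varphi_0-\varphi_1|\le C\min(\mathrm{Re}\,\varphi_0,\mathrm{Re}\,\varphi_1)$; \item $|\psi_0|\le C$ and $|\psi_1|\le C$; \item $|\varphi_0'-\varphi_1'|\le C$. \end{itemize} Then $C_{\varphi_0}$ and $C_{\varphi_1}$ belong to the same connected component of $\mathcal C(\mathcal H)$. If moreover $$|\varphi_0-\varphi_1|=o\big(\min(\mathrm{Re}\,\varphi_0,\mathrm{Re}\,\varphi_1)\big)\quad\text{and}\quad\varphi_0'-\varphi_1'\to0\quad\text{as }\min(\mathrm{Re}\,\varphi_0,\mathrm{Re}\,\varphi_1)\to0,$$ then $C_{\varphi_0}-C_{\varphi_1}$ is compact on $\mathcal H$.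
   Context: For $\theta\in\mathbb R$, $\mathbb C_\theta=\{s\in\mathbb C:\ \mathrm{Re}\, s>\theta\}$, $\mathbb C_+=\mathbb C_0$. $\mathcal H$ is the Hilbert space of Dirichlet series $f(s)=\sum_{n\ge1}a_nn^{-s}$ with $\|f\|^2=\sum_n|a_n|^2<\infty$; its elements are analytic on $\mathbb C_{1/2}$. The Gordon-Hedenmalm class $\mathcal G$ is the set of maps $\varphi:\mathbb C_{1/2}\to\mathbb C_{1/2}$ of the form $\varphi(s)=c_0s+\psi(s)$, where $c_0=:\mathrm{char}(\varphi)$ is a non-negative integer (the characteristic of $\varphi$) and $\psi(s)=\sum_{n\ge1}c_nn^{-s}$ converges uniformly in $\mathbb C_\varepsilon$ for every $\varepsilon>0$ and satisfies: (a) if $c_0=0$, then $\psi(\mathbb C_0)\subseteq\mathbb C_{1/2}$; (b) if $c_0\ge1$, then either $\psi\equiv c_1$ with $\mathrm{Re}\,c_1\ge0$ or $\psi(\mathbb C_0)\subseteq\mathbb C_0$. Such $\varphi$ is regarded as an analytic function on $\mathbb C_+$ by the same formula. These are exactly the symbols for which $C_\varphi f=f\circ\varphi$ defines a bounded operator on $\mathcal H$. $\mathcal C(\mathcal H)=\{C_\varphi:\ \varphi\in\mathcal G\}$ carries the operator norm topology. The asymptotic condition means: for every $\varepsilon>0$ there is $\theta>0$ such that for all $s\in\mathbb C_+$ with $\min(\mathrm{Re}\,\varphi_0(s),\mathrm{Re}\,\varphi_1(s))<\theta$ one has $|\varphi_0(s)-\varphi_1(s)|\le\varepsilon\min(\mathrm{Re}\,\varphi_0(s),\mathrm{Re}\,\varphi_1(s))$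 and $|\varphi_0'(s)-\varphi_1'(s)|\le\varepsilon$. *)

theory Defs
  imports "HOL-Analysis.Analysis"
begin

section \<open>The Hilbert space of Dirichlet series with square-summable coefficients\<close>

text \<open>
  An element of the space \<open>\<H>\<close> is given by its coefficients \<open>a\<^sub>1, a\<^sub>2, \<dots>\<close>; the unused
  entry of index 0 is normalised to 0.
\<close>

typedef dirichlet_h2 = "{a :: nat \<Rightarrow> complex. a 0 = 0 \<and> summable (\<lambda>n. (cmod (a n))\<^sup>2)}"
  morphisms dcoeff Abs_dirichlet_h2
  by (rule exI[of _ "\<lambda>_. 0"]) auto

lemma dcoeff_0 [simp]: "dcoeff f 0 = 0"
  and summable_dcoeff: "summable (\<lambda>n. (cmod (dcoeff f n))\<^sup>2)"
  using dcoeff[of f] by auto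

lemma dcoeff_Abs:
  "a 0 = 0 \<Longrightarrow> summable (\<lambda>n. (cmod (a n))\<^sup>2) \<Longrightarrow> dcoeff (Abs_dirichlet_h2 a) = a"
  by (simp add: Abs_dirichlet_h2_inverse)

lemma dirichlet_h2_eqI: "(\<And>n. dcoeff f n = dcoeff g n) \<Longrightarrow> f = g"
  using dcoeff_inject by (metis ext)

lemma summable_cmod_add_sq:
  assumes "summable (\<lambda>n. (cmod (a n))\<^sup>2)" "summable (\<lambda>n. (cmod (b n))\<^sup>2)"
  shows "summable (\<lambda>n. (cmod (a n + b n))\<^sup>2)"
proof (rule summable_comparison_test')
  show "summable (\<lambda>n. 2 * ((cmod (a n))\<^sup>2 + (cmod (b n))\<^sup>2))"
    by (intro summable_mult summable_add assms)
  fix n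
  have "(cmod (a n + b n))\<^sup>2 \<le> (cmod (a n) + cmod (b n))\<^sup>2"
    by (intro power_mono norm_triangle_ineq) auto
  also have "\<dots> \<le> 2 * ((cmod (a n))\<^sup>2 + (cmod (b n))\<^sup>2)"
    using sum_squares_bound[of "cmod (a n)" "cmod (b n)"] by (simp add: power2_sum)
  finally show "norm ((cmod (a n + b n))\<^sup>2) \<le> 2 * ((cmod (a n))\<^sup>2 + (cmod (b n))\<^sup>2)"
    by simp
qed

lemma summable_inner_coeff:
  fixes a b :: "nat \<Rightarrow> complex"
  assumes "summable (\<lambda>n. (cmod (a n))\<^sup>2)" "summable (\<lambda>n. (cmod (b n))\<^sup>2)"
  shows "summable (\<lambda>n. a n \<bullet> b n)"
proof (rule summable_comparison_test')
  show "summable (\<lambda>n. (cmod (a n))\<^sup>2 + (cmod (b n))\<^sup>2)"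
    by (intro summable_add assms)
  fix n
  have "norm (a n \<bullet> b n) \<le> cmod (a n) * cmod (b n)"
    using Cauchy_Schwarz_ineq2[of "a n" "b n"] by simp
  also have "\<dots> \<le> 2 * cmod (a n) * cmod (b n)" by simp
  also have "\<dots> \<le> (cmod (a n))\<^sup>2 + (cmod (b n))\<^sup>2" by (rule sum_squares_bound)
  finally show "norm (a n \<bullet> b n) \<le> (cmod (a n))\<^sup>2 + (cmod (b n))\<^sup>2" .
qed

text \<open>
  The real inner product is the real part of \<open>\<Sum>n. a\<^sub>n * cnj b\<^sub>n\<close>; the norm it induces is
  the norm of \<open>\<H>\<close>, as stated in \<open>norm_dirichlet_h2_sq\<close> below.
\<close>

instantiation dirichlet_h2 :: real_inner
begin

definition "0 = Abs_dirichlet_h2 (\<lambda>n. 0)"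
definition "f + g = Abs_dirichlet_h2 (\<lambda>n. dcoeff f n + dcoeff g n)"
definition "- f = Abs_dirichlet_h2 (\<lambda>n. - dcoeff f n)"
definition "f - g = Abs_dirichlet_h2 (\<lambda>n. dcoeff f n - dcoeff g n)"
definition "r *\<^sub>R f = Abs_dirichlet_h2 (\<lambda>n. r *\<^sub>R dcoeff f n)"
definition "f \<bullet> g = (\<Sum>n. dcoeff f n \<bullet> dcoeff g n)"
definition "norm (f :: dirichlet_h2) = sqrt (f \<bullet> f)"
definition "dist (f :: dirichlet_h2) g = norm (f - g)"
definition "sgn (f :: dirichlet_h2) = inverse (norm f) *\<^sub>R f"
definition [code del]:
  "(uniformity :: (dirichlet_h2 \<times> dirichlet_h2) filter) = (INF e\<in>{0<..}. principal {(x, y). dist x y < e})"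
definition [code del]:
  "open (U :: dirichlet_h2 set) \<longleftrightarrow> (\<forall>x\<in>U. \<forall>\<^sub>F (x', y) in uniformity. x' = x \<longrightarrow> y \<in> U)"

lemma dcoeff_zero: "dcoeff 0 n = 0"
  by (simp add: zero_dirichlet_h2_def dcoeff_Abs)

lemma dcoeff_add: "dcoeff (f + g) n = dcoeff f n + dcoeff g n"
  by (simp add: plus_dirichlet_h2_def dcoeff_Abs summable_cmod_add_sq summable_dcoeff)

lemma dcoeff_uminus: "dcoeff (- f) n = - dcoeff f n"
  by (simp add: uminus_dirichlet_h2_def dcoeff_Abs summable_dcoeff)

lemma dcoeff_diff: "dcoeff (f - g) n = dcoeff f n - dcoeff g n"
  using summable_cmod_add_sq[OF summable_dcoeff[of f], of "\<lambda>n. - dcoeff g n"]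
  by (simp add: minus_dirichlet_h2_def dcoeff_Abs summable_dcoeff)

lemma dcoeff_scaleR: "dcoeff (r *\<^sub>R f) n = r *\<^sub>R dcoeff f n"
  by (simp add: scaleR_dirichlet_h2_def dcoeff_Abs summable_dcoeff power_mult_distrib summable_mult)

lemmas dcoeff_simps = dcoeff_zero dcoeff_add dcoeff_uminus dcoeff_diff dcoeff_scaleR

instance
proof
  fix f g h :: dirichlet_h2 and r s :: real
  note sm = summable_inner_coeff[OF summable_dcoeff summable_dcoeff]
  show "f + g + h = f + (g + h)" "f + g = g + f" "0 + f = f" "- f + f = 0" "f - g = f + - g"
    "r *\<^sub>R (f + g) = r *\<^sub>R f + r *\<^sub>R g" "(r + s) *\<^sub>R f = r *\<^sub>R f + s *\<^sub>R f"
    "r *\<^sub>R s *\<^sub>R f = (r * s) *\<^sub>R f" "1 *\<^sub>R f = f"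
    by (auto intro!: dirichlet_h2_eqI simp: dcoeff_simps algebra_simps)
  show "f \<bullet> g = g \<bullet> f"
    by (simp add: inner_dirichlet_h2_def inner_commute)
  show "(f + g) \<bullet> h = f \<bullet> h + g \<bullet> h"
    by (simp add: inner_dirichlet_h2_def dcoeff_simps inner_add_left suminf_add sm)
  show "(r *\<^sub>R f) \<bullet> g = r * (f \<bullet> g)"
    by (simp add: inner_dirichlet_h2_def dcoeff_simps suminf_mult sm)
  show "0 \<le> f \<bullet> f"
    by (simp add: inner_dirichlet_h2_def suminf_nonneg sm)
  have "f \<bullet> f = 0 \<longleftrightarrow> (\<forall>n. dcoeff f n \<bullet> dcoeff f n = 0)"
    unfolding inner_dirichlet_h2_def by (rule suminf_eq_zero_iff) (auto simp: sm)
  also have "\<dots> \<longleftrightarrow> f = 0"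
    by (auto intro!: dirichlet_h2_eqI simp: dcoeff_simps)
  finally show "f \<bullet> f = 0 \<longleftrightarrow> f = 0" .
qed (simp_all add: norm_dirichlet_h2_def dist_dirichlet_h2_def sgn_dirichlet_h2_def
      uniformity_dirichlet_h2_def open_dirichlet_h2_def)

end

lemma norm_dirichlet_h2_sq: "(norm f)\<^sup>2 = (\<Sum>n. (cmod (dcoeff f n))\<^sup>2)"
  by (simp add: power2_norm_eq_inner inner_dirichlet_h2_def)

lemma sum_le_norm_dirichlet_h2_sq: "(\<Sum>n<K. (cmod (dcoeff f n))\<^sup>2) \<le> (norm f)\<^sup>2"
  unfolding norm_dirichlet_h2_sq by (rule sum_le_suminf) (auto simp: summable_dcoeff)

lemma cmod_dcoeff_le_norm: "cmod (dcoeff f n) \<le> norm f"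
proof (rule power2_le_imp_le)
  have "(cmod (dcoeff f n))\<^sup>2 \<le> (\<Sum>k<Suc n. (cmod (dcoeff f k))\<^sup>2)"
    by (simp add: sum_nonneg)
  then show "(cmod (dcoeff f n))\<^sup>2 \<le> (norm f)\<^sup>2"
    using sum_le_norm_dirichlet_h2_sq[of f "Suc n"] by linarith
qed simp

instance dirichlet_h2 :: banach
proof
  fix X :: "nat \<Rightarrow> dirichlet_h2"
  assume X: "Cauchy X"
  have "Cauchy (\<lambda>k. dcoeff (X k) n)" for n
  proof (rule metric_CauchyI)
    fix e :: real assume "e > 0"
    then obtain M where M: "\<forall>m\<ge>M. \<forall>k\<ge>M. dist (X m) (X k) < e"
      using X unfolding Cauchy_def by blast
    have "dist (dcoeff (X m) n) (dcoeff (X k) n) \<le> dist (X m) (X k)" for m k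
      using cmod_dcoeff_le_norm[of "X m - X k" n] by (simp add: dist_norm dcoeff_diff)
    with M show "\<exists>M. \<forall>m\<ge>M. \<forall>k\<ge>M. dist (dcoeff (X m) n) (dcoeff (X k) n) < e"
      by (meson le_less_trans)
  qed
  then have "\<forall>n. \<exists>l. (\<lambda>k. dcoeff (X k) n) \<longlonglongrightarrow> l"
    using Cauchy_convergent convergent_def by metis
  then obtain a where a: "\<And>n. (\<lambda>k. dcoeff (X k) n) \<longlonglongrightarrow> a n"
    by metis
  have a0: "a 0 = 0"
    using a[of 0] by (simp add: LIMSEQ_const_iff)
  have bound: "\<exists>M. \<forall>m\<ge>M. \<forall>K. (\<Sum>n<K. (cmod (dcoeff (X m) n - a n))\<^sup>2) \<le> e\<^sup>2" if "e > 0" for e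
  proof -
    obtain M where M: "\<forall>m\<ge>M. \<forall>k\<ge>M. dist (X m) (X k) < e"
      using metric_CauchyD[OF X \<open>e > 0\<close>] by blast
    have "(\<Sum>n<K. (cmod (dcoeff (X m) n - a n))\<^sup>2) \<le> e\<^sup>2" if m: "m \<ge> M" for m K
    proof (rule LIMSEQ_le_const2)
      show "(\<lambda>k. \<Sum>n<K. (cmod (dcoeff (X m) n - dcoeff (X k) n))\<^sup>2)
              \<longlonglongrightarrow> (\<Sum>n<K. (cmod (dcoeff (X m) n - a n))\<^sup>2)"
        by (intro tendsto_intros a)
      have "(\<Sum>n<K. (cmod (dcoeff (X m) n - dcoeff (X k) n))\<^sup>2) \<le> e\<^sup>2" if "k \<ge> M" for k
      proof -
        have "(\<Sum>n<K. (cmod (dcoeff (X m) n - dcoeff (X k) n))\<^sup>2) \<le> (norm (X m - X k))\<^sup>2"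
          using sum_le_norm_dirichlet_h2_sq[of "X m - X k" K] by (simp add: dcoeff_diff)
        also have "\<dots> \<le> e\<^sup>2"
          using M m that by (intro power_mono) (auto simp: dist_norm less_imp_le)
        finally show ?thesis .
      qed
      then show "\<exists>N. \<forall>k\<ge>N. (\<Sum>n<K. (cmod (dcoeff (X m) n - dcoeff (X k) n))\<^sup>2) \<le> e\<^sup>2"
        by blast
    qed
    then show ?thesis by blast
  qed
  have diff_summable: "summable (\<lambda>n. (cmod (dcoeff (X m) n - a n))\<^sup>2)"
    if "\<forall>K. (\<Sum>n<K. (cmod (dcoeff (X m) n - a n))\<^sup>2) \<le> e\<^sup>2" for m e
  proof (rule summableI_nonneg_bounded)
    show "(\<Sum>n<K. (cmod (dcoeff (X m) n - a n))\<^sup>2) \<le> e\<^sup>2" for K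
      using that by blast
  qed simp
  obtain M where M: "\<forall>K. (\<Sum>n<K. (cmod (dcoeff (X M) n - a n))\<^sup>2) \<le> 1\<^sup>2"
    using bound[of 1] by auto
  have "summable (\<lambda>n. (cmod (a n))\<^sup>2)"
    using summable_cmod_add_sq[OF summable_dcoeff[of "X M"], of "\<lambda>n. - (dcoeff (X M) n - a n)"]
      diff_summable[OF M] by (simp add: norm_minus_commute)
  then have dA: "dcoeff (Abs_dirichlet_h2 a) = a"
    by (intro dcoeff_Abs a0)
  have "X \<longlonglongrightarrow> Abs_dirichlet_h2 a"
  proof (rule metric_LIMSEQ_I)
    fix r :: real assume "r > 0"
    then obtain M where M: "\<And>m. m \<ge> M \<Longrightarrow> \<forall>K. (\<Sum>n<K. (cmod (dcoeff (X m) n - a n))\<^sup>2) \<le> (r/2)\<^sup>2"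
      using bound[of "r/2"] by auto
    have "dist (X m) (Abs_dirichlet_h2 a) < r" if "m \<ge> M" for m
    proof -
      have "(norm (X m - Abs_dirichlet_h2 a))\<^sup>2 \<le> (r/2)\<^sup>2"
        unfolding norm_dirichlet_h2_sq dcoeff_diff dA
        using diff_summable[OF M[OF that]] M[OF that] by (intro suminf_le_const) auto
      then have "norm (X m - Abs_dirichlet_h2 a) \<le> r/2"
        by (rule power2_le_imp_le) (use \<open>r > 0\<close> in simp)
      with \<open>r > 0\<close> show ?thesis by (simp add: dist_norm)
    qed
    then show "\<exists>M. \<forall>m\<ge>M. dist (X m) (Abs_dirichlet_h2 a) < r" by blast
  qed
  then show "convergent X" by (rule convergentI)
qed

text \<open>
  The sum of the Dirichlet series, meaningful for \<open>Re s > 1/2\<close>.  The term of index 0 vanishes.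
\<close>

definition dirichlet_eval :: "dirichlet_h2 \<Rightarrow> complex \<Rightarrow> complex" where
  "dirichlet_eval f s = (\<Sum>n. dcoeff f n * of_nat n powr (- s))"


section \<open>The Gordon--Hedenmalm class and its composition operators\<close>

definition half_plane :: "real \<Rightarrow> complex set" where
  "half_plane \<theta> = {s. Re s > \<theta>}"

text \<open>
  Symbols are represented by total functions, of which only the values on \<open>half_plane 0\<close>,
  given by \<open>c\<^sub>0 s + \<psi>(s)\<close>, are meaningful.
\<close>

definition gh_symbol :: "nat \<Rightarrow> (complex \<Rightarrow> complex) \<Rightarrow> bool" where
  "gh_symbol c0 \<phi> \<longleftrightarrow> \<phi> ` half_plane (1/2) \<subseteq> half_plane (1/2) \<and>
     (\<exists>c \<psi>. (\<forall>s\<in>half_plane 0. \<phi> s = of_nat c0 * s + \<psi> s) \<and>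
        (\<forall>\<epsilon>>0. uniform_limit (half_plane \<epsilon>) (\<lambda>N s. \<Sum>n=1..N. c n * of_nat n powr (- s)) \<psi> sequentially) \<and>
        (c0 = 0 \<longrightarrow> \<psi> ` half_plane 0 \<subseteq> half_plane (1/2)) \<and>
        (c0 \<ge> 1 \<longrightarrow> ((\<forall>s\<in>half_plane 0. \<psi> s = c 1) \<and> Re (c 1) \<ge> 0) \<or>
                    \<psi> ` half_plane 0 \<subseteq> half_plane 0))"

definition GH_class :: "(complex \<Rightarrow> complex) set" where
  "GH_class = {\<phi>. \<exists>c0. gh_symbol c0 \<phi>}"

definition gh_char :: "(complex \<Rightarrow> complex) \<Rightarrow> nat" where
  "gh_char \<phi> = (THE c0. gh_symbol c0 \<phi>)"

text \<open>
  The element \<open>f \<circ> \<phi>\<close> of \<open>\<H>\<close>: a Dirichlet series is determined by its values on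
  \<open>half_plane (1/2)\<close>.
\<close>

definition dirichlet_compose :: "(complex \<Rightarrow> complex) \<Rightarrow> dirichlet_h2 \<Rightarrow> dirichlet_h2" where
  "dirichlet_compose \<phi> f =
     (THE g. \<forall>s\<in>half_plane (1/2). dirichlet_eval g s = dirichlet_eval f (\<phi> s))"

text \<open>
  By the theorem of Gordon and Hedenmalm, for \<open>\<phi>\<close> in \<open>GH_class\<close> the map
  \<open>dirichlet_compose \<phi>\<close> is everywhere defined, linear and bounded.  The type \<open>\<Rightarrow>\<^sub>L\<close> of
  real-linear bounded operators carries the operator norm; composition operators are
  automatically complex-linear.
\<close>

definition comp_op :: "(complex \<Rightarrow> complex) \<Rightarrow> dirichlet_h2 \<Rightarrow>\<^sub>L dirichlet_h2" where
  "comp_op \<phi> = Blinfun (dirichlet_compose \<phi>)"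

definition comp_ops :: "(dirichlet_h2 \<Rightarrow>\<^sub>L dirichlet_h2) set" where
  "comp_ops = comp_op ` GH_class"

definition compact_operator ::
  "('a::real_normed_vector \<Rightarrow>\<^sub>L 'b::real_normed_vector) \<Rightarrow> bool" where
  "compact_operator T \<longleftrightarrow> compact (closure (blinfun_apply T ` cball 0 1))"

end

theory Submission
  imports Defs
begin

text \<open>
  Write \<open>f = \<Sum> a\<^sub>n n\<^sup>-\<^sup>s\<close> for a finite Dirichlet series.  Everything rests on one explicit function on the
  right half-plane,
  \<open>u\<^sub>f(w) = \<Sum>\<^sub>k (k\<^sup>2\<^sup>x - (k-1)\<^sup>2\<^sup>x) |\<Sum>\<^sub>m\<^sub>\<ge>\<^sub>k a\<^sub>m m\<^sup>-\<^sup>w|\<^sup>2\<close> with \<open>x = Re w\<close>, which is the Poisson extension of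
  the boundary values of \<open>|f|\<^sup>2\<close> (\<open>majorant\<close> below).  It has three properties.

  \<^item> It dominates: \<open>|f(w)|\<^sup>2 \<le> u\<^sub>f(w)\<close> (\<open>cmod_dpoly_le_majorant\<close>).

  \<^item> It controls increments at hyperbolic scale:
    \<open>|f(w') - f(w)|\<^sup>2 \<le> |w' - w|\<^sup>2 / (4 Re w Re w') \<cdot> u\<^sub>f(w)\<close> (\<open>dpoly_diff_bound\<close>), by Abel summation and
    the Cauchy--Schwarz inequality.

  \<^item> Its mean along vertical lines survives composition: \<open>u\<^sub>f\<close> is a finite combination of the functions
    \<open>(m/n)\<^sup>-\<^sup>w\<close> with \<open>m \<ge> n\<close> and their conjugates, and if \<open>\<phi>(s) = c\<^sub>0 s + \<psi>(s)\<close> with \<open>c\<^sub>0 \<ge> 1\<close> then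
    \<open>(m/n)\<^sup>-\<^sup>\<phi>\<close> has only positive frequencies for \<open>m > n\<close>.  So the mean of \<open>u\<^sub>f \<circ> \<phi>\<close> is \<open>\<Sum> |a\<^sub>n|\<^sup>2\<close>
    (\<open>vmean_majorant\<close>).

  A function that is a uniform limit of Dirichlet polynomials on each \<open>Re s > \<epsilon>\<close>, and whose squared modulus is
  dominated by something of mean \<open>M\<close> on each vertical line, belongs to \<open>\<H>\<close> with squared norm at most \<open>M\<close>
  (\<open>dirichlet_h2_of_majorized\<close>).  Applied to \<open>f \<circ> \<phi>\<close> this is the Gordon--Hedenmalm theorem: \<open>C\<^sub>\<phi>\<close> is a
  contraction.

  For connectedness, join the symbols by \<open>\<phi>\<^sub>t = (1-t) \<phi>\<^sub>0 + t \<phi>\<^sub>1\<close>.  Since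
  \<open>|\<phi>\<^sub>t - \<phi>\<^sub>u|\<^sup>2 \<le> (C |t-u|)\<^sup>2 Re \<phi>\<^sub>t Re \<phi>\<^sub>u\<close>, the increment estimate gives
  \<open>|f \<circ> \<phi>\<^sub>t - f \<circ> \<phi>\<^sub>u|\<^sup>2 \<le> (C |t-u| / 2)\<^sup>2 u\<^sub>f \<circ> \<phi>\<^sub>u\<close>, and taking means shows that \<open>t \<mapsto> C\<^sub>\<phi>\<^sub>t\<close> is
  Lipschitz for the operator norm (\<open>comp_op_diff_Lipschitz\<close>).

  For compactness it suffices that \<open>C\<^sub>\<phi>\<^sub>0 - C\<^sub>\<phi>\<^sub>1\<close> is small on series that start late (\<open>compact_operatorI\<close>).
  Where the smaller of \<open>Re \<phi>\<^sub>0\<close> and \<open>Re \<phi>\<^sub>1\<close> is below \<open>\<theta>\<close>, the increment estimate gives the bound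
  \<open>\<epsilon>\<^sup>2/4 \<cdot> u\<^sub>f \<circ> \<phi>\<^sub>1\<close>.  Elsewhere both symbols
  have real part at least \<open>\<theta>\<close>, and \<open>|f(\<phi>\<^sub>j(s))|\<^sup>2\<close> is compared with the majorant of the shifted series
  \<open>f(\<cdot> + \<theta>/2)\<close> at the point \<open>c\<^sub>0 s + 1\<close>, which stays within bounded distance of \<open>\<phi>\<^sub>j(s)\<close> because \<open>\<psi>\<^sub>j\<close> is
  bounded; the shift gains a factor \<open>N\<^sup>-\<^sup>\<theta>\<close> for series starting after \<open>N\<close> (\<open>comp_op_diff_tail\<close>).
\<close>

section \<open>Finite Dirichlet series and the majorant of their squared modulus\<close>

definition dpoly :: "(nat \<Rightarrow> complex) \<Rightarrow> nat \<Rightarrow> complex \<Rightarrow> complex" where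
  "dpoly a N s = (\<Sum>n=1..N. a n * of_nat n powr (- s))"

text \<open>
  At \<open>k = 1\<close> the weight is \<open>1\<close>, because \<open>0 powr x = 0\<close>, and the inner sum is the whole series; the other
  summands are what the Poisson extension of \<open>|f|\<^sup>2\<close> adds to \<open>|f|\<^sup>2\<close>.
\<close>

definition majorant :: "(nat \<Rightarrow> complex) \<Rightarrow> nat \<Rightarrow> complex \<Rightarrow> real" where
  "majorant a N w = (\<Sum>k=1..N. (real k powr (2 * Re w) - real (k - 1) powr (2 * Re w)) *
     (cmod (\<Sum>m=k..N. a m * of_nat m powr (- w)))\<^sup>2)"

lemma nat_powr_exp: "n \<ge> 1 \<Longrightarrow> of_nat n powr (- s) = exp (- (s * complex_of_real (ln (real n))))"
proof -
  assume "n \<ge> 1"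
  then have "Ln (of_nat n) = complex_of_real (ln (real n))"
    using Ln_of_real[of "real n"] by simp
  then show ?thesis using \<open>n \<ge> 1\<close> by (simp add: powr_def)
qed

lemma cmod_nat_powr: "n \<ge> 1 \<Longrightarrow> cmod (of_nat n powr (- s)) = real n powr (- Re s)"
  by (simp add: nat_powr_exp powr_def)

lemma majorant_summand_nonneg:
  assumes "Re w \<ge> 0"
  shows "(real k powr (2 * Re w) - real (k - 1) powr (2 * Re w)) * (cmod z)\<^sup>2 \<ge> 0"
proof -
  have "real (k - 1) powr (2 * Re w) \<le> real k powr (2 * Re w)"
    by (rule powr_mono2) (use assms in auto)
  then show ?thesis by simp
qed

lemma cmod_dpoly_le_majorant:
  assumes "Re w \<ge> 0"
  shows "(cmod (dpoly a N w))\<^sup>2 \<le> majorant a N w"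
proof (cases "N \<ge> 1")
  case True
  let ?g = "\<lambda>k. (real k powr (2 * Re w) - real (k - 1) powr (2 * Re w)) *
     (cmod (\<Sum>m=k..N. a m * of_nat m powr (- w)))\<^sup>2"
  have "?g 1 \<le> (\<Sum>k=1..N. ?g k)"
  proof (rule member_le_sum)
    show "0 \<le> ?g k" for k by (rule majorant_summand_nonneg[OF assms])
  qed (use True in auto)
  then show ?thesis by (simp add: majorant_def dpoly_def)
qed (simp add: majorant_def dpoly_def)

lemma majorant_nonneg: "Re w \<ge> 0 \<Longrightarrow> majorant a N w \<ge> 0"
  using cmod_dpoly_le_majorant[of w a N] by (smt (verit) zero_le_power2)

text \<open>
  The increment of \<open>exp (- d t)\<close> is the integral of \<open>d exp (- d t)\<close>, whose modulus splits as
  \<open>|d| e\<^sup>x\<^sup>t \<cdot> e\<^sup>-\<^sup>y\<^sup>t\<close>; the right-hand side is the Cauchy--Schwarz bound of that integral.  The integrals are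
  avoided by bounding the product through the weighted inequality \<open>2 p q \<le> l p\<^sup>2 + q\<^sup>2 / l\<close> and comparing
  derivatives; the best weight \<open>l\<close> recovers Cauchy--Schwarz.
\<close>

lemma exp_increment_bound:
  fixes a b x y :: real and d :: complex
  assumes "a < b" "x > 0" "y > 0" and d: "Re d = y - x"
  shows "(cmod (exp (- (d * b)) - exp (- (d * a))))\<^sup>2 \<le>
    (cmod d)\<^sup>2 / (4 * x * y) * ((exp (2 * x * b) - exp (2 * x * a)) * (exp (- (2 * y * a)) - exp (- (2 * y * b))))"
proof -
  define A where "A = (exp (2 * x * b) - exp (2 * x * a)) / (2 * x)"
  define B where "B = (exp (- (2 * y * a)) - exp (- (2 * y * b))) / (2 * y)"
  have pos: "A > 0" "B > 0" using assms by (auto simp: A_def B_def)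
  \<comment> \<open>the weight that balances the two terms \<open>l A\<close> and \<open>B / l\<close>\<close>
  define l where "l = sqrt (B / A)"
  have l: "l > 0" using pos by (simp add: l_def)
  define p where "p t = cmod d / 2 * (l * exp (2 * x * t) / (2 * x) - exp (- (2 * y * t)) / (2 * y * l))" for t :: real
  have "norm (exp (- (d * complex_of_real b)) - exp (- (d * complex_of_real a))) \<le> p b - p a"
  proof (rule differentiable_bound_general[OF \<open>a < b\<close>])
    fix t :: real
    show "((\<lambda>t. exp (- (d * complex_of_real t))) has_vector_derivative (- d * exp (- (d * complex_of_real t)))) (at t)"
      by (rule has_vector_derivative_real_field) (auto intro!: derivative_eq_intros)
    show "(p has_vector_derivative (cmod d / 2 * (l * exp (2 * x * t) + exp (- (2 * y * t)) / l))) (at t)"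
      unfolding p_def has_real_derivative_iff_has_vector_derivative[symmetric]
      using \<open>x > 0\<close> \<open>y > 0\<close> l by (auto intro!: derivative_eq_intros simp: field_simps)
    have "2 * exp (- ((y - x) * t)) \<le> l * exp (2 * x * t) + exp (- (2 * y * t)) / l"
    proof -
      have "0 \<le> (sqrt l * exp (x * t) - exp (- (y * t)) / sqrt l)\<^sup>2" by simp
      also have "\<dots> = l * exp (x * t) ^ 2 + exp (- (y * t)) ^ 2 / l - 2 * (exp (x * t) * exp (- (y * t)))"
        using l by (simp add: power2_diff power_mult_distrib power_divide)
      also have "\<dots> = l * exp (2 * x * t) + exp (- (2 * y * t)) / l - 2 * exp (- ((y - x) * t))"
        by (simp add: exp_double[symmetric] exp_add[symmetric] algebra_simps)
      finally show ?thesis by simp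
    qed
    then show "norm (- d * exp (- (d * complex_of_real t))) \<le> cmod d / 2 * (l * exp (2 * x * t) + exp (- (2 * y * t)) / l)"
      using d mult_left_mono[of "2 * exp (- ((y - x) * t))" "l * exp (2 * x * t) + exp (- (2 * y * t)) / l" "cmod d / 2"]
      by (simp add: norm_mult)
  qed (use assms l in \<open>auto intro!: continuous_intros simp: p_def\<close>)
  also have "p b - p a = cmod d / 2 * (l * A + B / l)"
    unfolding p_def A_def B_def using assms l by (simp add: field_simps)
  also have "l * A + B / l = 2 * sqrt (A * B)"
    using pos by (simp add: l_def real_sqrt_divide real_sqrt_mult field_simps)
  finally have "(cmod (exp (- (d * b)) - exp (- (d * a))))\<^sup>2 \<le> (cmod d * sqrt (A * B))\<^sup>2"
    by (intro power_mono) auto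
  also have "\<dots> = (cmod d)\<^sup>2 * (A * B)" using pos by (simp add: power_mult_distrib)
  also have "\<dots> = (cmod d)\<^sup>2 / (4 * x * y) * ((exp (2 * x * b) - exp (2 * x * a)) * (exp (- (2 * y * a)) - exp (- (2 * y * b))))"
    using assms by (simp add: A_def B_def)
  finally show ?thesis .
qed

lemma sum_triangle_swap:
  fixes F :: "nat \<Rightarrow> nat \<Rightarrow> 'a::comm_monoid_add"
  shows "(\<Sum>m=1..N. \<Sum>k=1..m. F m k) = (\<Sum>k=1..N. \<Sum>m=k..N. F m k)"
proof -
  have "(\<Sum>m=1..N. \<Sum>k=1..m. F m k) = (\<Sum>m\<in>{1..N}. \<Sum>k\<in>{k\<in>{1..N}. k \<le> m}. F m k)"
    by (intro sum.cong refl) auto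
  also have "\<dots> = (\<Sum>k\<in>{1..N}. \<Sum>m\<in>{m\<in>{1..N}. k \<le> m}. F m k)"
    by (rule sum.swap_restrict) auto
  also have "\<dots> = (\<Sum>k=1..N. \<Sum>m=k..N. F m k)"
    by (intro sum.cong refl) auto
  finally show ?thesis .
qed

lemma sum_increments:
  fixes g :: "nat \<Rightarrow> 'a::ab_group_add"
  shows "g 0 = 0 \<Longrightarrow> (\<Sum>k=1..m. g k - g (k - 1)) = g m"
  by (induction m) auto

text \<open>
  Abel summation writes \<open>f(w') - f(w)\<close> in terms of the tails \<open>\<Sum>\<^sub>m\<^sub>\<ge>\<^sub>k a\<^sub>m m\<^sup>-\<^sup>w\<close> that occur in the majorant, with
  coefficients \<open>k\<^sup>-\<^sup>d - (k-1)\<^sup>-\<^sup>d\<close> for \<open>d = w' - w\<close>.  By \<open>exp_increment_bound\<close>, on the intervals from \<open>ln (k-1)\<close> to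
  \<open>ln k\<close>, each squared coefficient is at most the weight of that tail in the majorant times a term of a
  telescoping sum, up to the common factor \<open>|d|\<^sup>2 / (4 Re w Re w')\<close>.
\<close>

lemma dpoly_diff_bound:
  assumes w: "Re w > 0" and w': "Re w' > 0"
  shows "(cmod (dpoly a N w' - dpoly a N w))\<^sup>2 \<le>
    (cmod (w' - w))\<^sup>2 / (4 * Re w * Re w') * majorant a N w"
proof -
  define d where "d = w' - w"
  \<comment> \<open>\<open>e 0 = 0\<close> matches \<open>0 powr x = 0\<close> in the majorant, so that the increments start at \<open>k = 1\<close>\<close>
  define e where "e k = (if k = 0 then 0 else exp (- (d * complex_of_real (ln (real k)))))" for k :: nat
  define S where "S k = (\<Sum>m=k..N. a m * of_nat m powr (- w))" for k
  define G where "G k = real k powr (2 * Re w) - real (k - 1) powr (2 * Re w)" for k :: nat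
  define H where "H k = real (k - 1) powr (- 2 * Re w') - real k powr (- 2 * Re w')" for k :: nat
  define c where "c = (cmod d)\<^sup>2 / (4 * Re w * Re w')"
  have c0: "c \<ge> 0" using w w' by (simp add: c_def)
  have "dpoly a N w' = (\<Sum>m=1..N. (a m * of_nat m powr (- w)) * e m)"
    unfolding dpoly_def
    by (intro sum.cong refl)
      (auto simp: nat_powr_exp e_def d_def exp_add[symmetric] algebra_simps)
  also have "\<dots> = (\<Sum>m=1..N. \<Sum>k=1..m. (a m * of_nat m powr (- w)) * (e k - e (k - 1)))"
    by (subst sum_distrib_left[symmetric], subst sum_increments) (auto simp: e_def)
  also have "\<dots> = (\<Sum>k=1..N. (e k - e (k - 1)) * S k)"
    by (subst sum_triangle_swap) (simp add: S_def sum_distrib_left mult.commute)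
  finally have 1: "dpoly a N w' = (\<Sum>k=1..N. (e k - e (k - 1)) * S k)" .
  show ?thesis
  proof (cases "N \<ge> 1")
    case True
    have G0: "G k \<ge> 0" for k
      unfolding G_def using w by (simp del: of_nat_diff add: powr_mono2)
    have H0: "H k \<ge> 0" if "k \<ge> 2" for k
      unfolding H_def using w' that by (simp add: powr_mono2')
    have "dpoly a N w' - dpoly a N w = (\<Sum>k=2..N. (e k - e (k - 1)) * S k)"
      unfolding 1 using True
      by (subst sum.atLeast_Suc_atMost) (auto simp: e_def S_def dpoly_def numeral_2_eq_2)
    also have "cmod \<dots> \<le> (\<Sum>k=2..N. sqrt (c * H k) * (sqrt (G k) * cmod (S k)))"
    proof (rule order.trans[OF norm_sum], rule sum_mono)
      fix k assume k: "k \<in> {2..N}"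
      have "(cmod (e k - e (k - 1)))\<^sup>2 \<le> c * (G k * H k)"
        using exp_increment_bound[of "ln (real (k-1))" "ln (real k)" "Re w" "Re w'" d] k w w'
        by (auto simp: e_def G_def H_def c_def d_def powr_def)
      then have "cmod (e k - e (k - 1)) \<le> sqrt (c * (G k * H k))"
        by (rule real_le_rsqrt)
      then show "norm ((e k - e (k - 1)) * S k) \<le> sqrt (c * H k) * (sqrt (G k) * cmod (S k))"
        by (auto simp: norm_mult real_sqrt_mult mult_ac dest: mult_right_mono[of _ _ "cmod (S k)"])
    qed
    finally have "(cmod (dpoly a N w' - dpoly a N w))\<^sup>2 \<le> (\<Sum>k=2..N. sqrt (c * H k) * (sqrt (G k) * cmod (S k)))\<^sup>2"
      by (intro power_mono) auto
    also have "\<dots> \<le> (\<Sum>k=2..N. (sqrt (c * H k))\<^sup>2) * (\<Sum>k=2..N. (sqrt (G k) * cmod (S k))\<^sup>2)"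
      by (rule Cauchy_Schwarz_ineq_sum)
    also have "\<dots> = c * (\<Sum>k=2..N. H k) * (\<Sum>k=2..N. G k * (cmod (S k))\<^sup>2)"
    proof -
      have "(\<Sum>k=2..N. (sqrt (c * H k))\<^sup>2) = (\<Sum>k=2..N. c * H k)"
        using H0 c0 by (intro sum.cong refl) simp
      moreover have "(\<Sum>k=2..N. (sqrt (G k) * cmod (S k))\<^sup>2) = (\<Sum>k=2..N. G k * (cmod (S k))\<^sup>2)"
        using G0 by (simp add: power_mult_distrib)
      ultimately show ?thesis by (simp only: sum_distrib_left[symmetric])
    qed
    also have "\<dots> \<le> c * 1 * majorant a N w"
    proof (intro mult_mono)
      have "(\<Sum>k=2..N. H k) = 1 - real N powr (- 2 * Re w')"
        using True unfolding H_def by (induction N rule: dec_induct) auto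
      then show "(\<Sum>k=2..N. H k) \<le> 1" by simp
      show "(\<Sum>k=2..N. G k * (cmod (S k))\<^sup>2) \<le> majorant a N w"
        unfolding majorant_def G_def[symmetric] S_def[symmetric]
        by (rule sum_mono2) (use G0 in auto)
    qed (use c0 G0 H0 in \<open>auto intro!: sum_nonneg\<close>)
    finally show ?thesis by (simp add: c_def d_def)
  qed (simp add: dpoly_def majorant_def)
qed

text \<open>
  This is \<open>(m/n)\<^sup>-\<^sup>w\<close> if \<open>m \<ge> n\<close>, and the conjugate of \<open>(n/m)\<^sup>-\<^sup>w\<close> otherwise: the Poisson extension of
  \<open>m\<^sup>-\<^sup>w \<cdot> cnj (n\<^sup>-\<^sup>w)\<close> from the imaginary axis.
\<close>

definition pairing_kernel :: "nat \<Rightarrow> nat \<Rightarrow> complex \<Rightarrow> complex" where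
  "pairing_kernel m n w = of_nat m powr (- w) * cnj (of_nat n powr (- w)) * of_real (real (min m n) powr (2 * Re w))"

text \<open>
  Expanding the squares, the pair \<open>(m, n)\<close> occurs for all \<open>k \<le> min m n\<close>, and the weights telescope to
  \<open>(min m n)\<^sup>2\<^sup>x\<close>.
\<close>

lemma majorant_expand:
  "complex_of_real (majorant a N w) = (\<Sum>m=1..N. \<Sum>n=1..N. a m * cnj (a n) * pairing_kernel m n w)"
proof -
  define b where "b m = a m * of_nat m powr (- w)" for m
  define g where "g k = real k powr (2 * Re w)" for k :: nat
  have "complex_of_real (majorant a N w) =
      (\<Sum>k=1..N. complex_of_real (g k - g (k - 1)) * ((\<Sum>m=k..N. b m) * cnj (\<Sum>m=k..N. b m)))"
    unfolding majorant_def g_def b_def by (simp only: of_real_sum of_real_mult complex_norm_square)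
  also have "\<dots> = (\<Sum>k\<in>{1..N}. \<Sum>p\<in>{p\<in>{1..N}\<times>{1..N}. k \<le> min (fst p) (snd p)}.
      of_real (g k - g (k - 1)) * (b (fst p) * cnj (b (snd p))))"
  proof (intro sum.cong refl)
    fix k assume "k \<in> {1..N}"
    then have "{p\<in>{1..N}\<times>{1..N}. k \<le> min (fst p) (snd p)} = {k..N} \<times> {k..N}"
      by auto
    then show "of_real (g k - g (k - 1)) * ((\<Sum>m=k..N. b m) * cnj (\<Sum>m=k..N. b m)) =
      (\<Sum>p\<in>{p\<in>{1..N}\<times>{1..N}. k \<le> min (fst p) (snd p)}. of_real (g k - g (k - 1)) * (b (fst p) * cnj (b (snd p))))"
      by (simp only: sum_product cnj_sum) (simp only: sum_distrib_left sum.cartesian_product case_prod_beta)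
  qed
  also have "\<dots> = (\<Sum>p\<in>{1..N}\<times>{1..N}. \<Sum>k\<in>{k\<in>{1..N}. k \<le> min (fst p) (snd p)}.
      of_real (g k - g (k - 1)) * (b (fst p) * cnj (b (snd p))))"
    by (rule sum.swap_restrict) auto
  also have "\<dots> = (\<Sum>p\<in>{1..N}\<times>{1..N}. of_real (g (min (fst p) (snd p))) * (b (fst p) * cnj (b (snd p))))"
  proof (intro sum.cong refl)
    fix p assume "p \<in> {1..N} \<times> {1..N}"
    then have "{k\<in>{1..N}. k \<le> min (fst p) (snd p)} = {1..min (fst p) (snd p)}" by auto
    moreover have "(\<Sum>k=1..M. complex_of_real (g k - g (k - 1))) = of_real (g M)" for M
      unfolding of_real_sum[symmetric] by (subst sum_increments) (auto simp: g_def)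
    ultimately show "(\<Sum>k\<in>{k\<in>{1..N}. k \<le> min (fst p) (snd p)}. of_real (g k - g (k - 1)) * (b (fst p) * cnj (b (snd p))))
       = of_real (g (min (fst p) (snd p))) * (b (fst p) * cnj (b (snd p)))"
      by (simp only: sum_distrib_right[symmetric])
  qed
  also have "\<dots> = (\<Sum>m=1..N. \<Sum>n=1..N. a m * cnj (a n) * pairing_kernel m n w)"
    unfolding sum.cartesian_product by (intro sum.cong refl) (auto simp: pairing_kernel_def b_def g_def)
  finally show ?thesis .
qed

lemma pairing_kernel_diag: "n \<ge> 1 \<Longrightarrow> pairing_kernel n n w = 1"
proof -
  assume n: "n \<ge> 1"
  have "of_nat n powr (- w) * cnj (of_nat n powr (- w)) = complex_of_real ((real n powr (- Re w))\<^sup>2)"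
    using n cmod_nat_powr[of n w] by (simp only: complex_norm_square[symmetric])
  moreover have "(real n powr (- Re w))\<^sup>2 * real n powr (2 * Re w) = 1"
    using n by (simp add: power2_eq_square powr_add[symmetric])
  ultimately show ?thesis unfolding pairing_kernel_def by (simp only: of_real_mult[symmetric]) simp
qed

lemma pairing_kernel_less:
  "1 \<le> n \<Longrightarrow> n < m \<Longrightarrow> pairing_kernel m n w = exp (- (w * complex_of_real (ln (real m) - ln (real n))))"
proof -
  assume mn: "1 \<le> n" "n < m"
  have "cnj w = of_real (2 * Re w) - w" by (simp add: complex_eq_iff)
  then have e: "- (w * of_real (ln (real m))) + - (cnj w * of_real (ln (real n))) + of_real (2 * Re w * ln (real n))
      = - (w * complex_of_real (ln (real m) - ln (real n)))"
    by (simp only: of_real_mult of_real_diff) (simp add: algebra_simps)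
  have "pairing_kernel m n w =
      exp (- (w * of_real (ln (real m))) + - (cnj w * of_real (ln (real n))) + of_real (2 * Re w * ln (real n)))"
    using mn by (simp add: pairing_kernel_def nat_powr_exp exp_cnj powr_def exp_of_real[symmetric] exp_add[symmetric])
  then show ?thesis unfolding e .
qed

lemma pairing_kernel_swap: "pairing_kernel m n w = cnj (pairing_kernel n m w)"
  by (simp add: pairing_kernel_def min.commute mult_ac)

section \<open>Uniform limits of Dirichlet polynomials\<close>

lemma Re_half_plane_pos: "s \<in> half_plane e \<Longrightarrow> e > 0 \<Longrightarrow> s \<in> half_plane 0"
  by (simp add: half_plane_def)

lemma dpoly_pad:
  assumes "N \<le> M"
  shows "dpoly a N = dpoly (\<lambda>n. if n \<le> N then a n else 0) M"
proof
  fix s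
  show "dpoly a N s = dpoly (\<lambda>n. if n \<le> N then a n else 0) M s"
    unfolding dpoly_def
    by (rule sum.mono_neutral_cong_left) (use assms in auto)
qed

lemma dpoly_add_coeff: "dpoly (\<lambda>n. a n + b n) N s = dpoly a N s + dpoly b N s"
  by (simp add: dpoly_def sum.distrib algebra_simps)

lemma dpoly_diff_coeff: "dpoly (\<lambda>n. a n - b n) N s = dpoly a N s - dpoly b N s"
  by (simp add: dpoly_def sum_subtractf algebra_simps)

lemma dpoly_add_ex: "\<exists>c K. \<forall>s. dpoly a N s + dpoly b M s = dpoly c K s"
proof (intro exI allI)
  fix s
  show "dpoly a N s + dpoly b M s =
      dpoly (\<lambda>n. (if n \<le> N then a n else 0) + (if n \<le> M then b n else 0)) (max N M) s"
    unfolding dpoly_add_coeff dpoly_pad[of N "max N M" a, OF max.cobounded1]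
      dpoly_pad[of M "max N M" b, OF max.cobounded2] by (rule refl)
qed

lemma nat_mult_powr:
  assumes "m \<ge> 1" "n \<ge> 1"
  shows "of_nat (m * n) powr (- s) = of_nat m powr (- s) * (of_nat n powr (- s) :: complex)"
proof -
  have "m * n \<ge> 1" using assms by (simp add: Suc_le_eq)
  then show ?thesis
    using assms by (simp only: nat_powr_exp) (simp add: ln_mult exp_add[symmetric] algebra_simps)
qed

lemma dpoly_mult_ex: "\<exists>c K. \<forall>s. dpoly a N s * dpoly b M s = dpoly c K s"
proof (intro exI allI)
  fix s
  let ?S = "{1..N} \<times> {1..M}" and ?g = "\<lambda>p::nat\<times>nat. fst p * snd p"
  have "dpoly a N s * dpoly b M s = (\<Sum>p\<in>?S. a (fst p) * b (snd p) * of_nat (?g p) powr (- s))"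
    unfolding dpoly_def sum_product sum.cartesian_product
  proof (intro sum.cong refl)
    fix p assume "p \<in> ?S"
    then have "of_nat (?g p) powr (- s) = of_nat (fst p) powr (- s) * (of_nat (snd p) powr (- s) :: complex)"
      by (intro nat_mult_powr) auto
    then show "(case p of (m, n) \<Rightarrow> a m * of_nat m powr (- s) * (b n * of_nat n powr (- s))) =
        a (fst p) * b (snd p) * of_nat (?g p) powr (- s)"
      by (simp only: case_prod_beta mult_ac)
  qed
  also have "\<dots> = (\<Sum>k=1..N*M. \<Sum>p\<in>{p\<in>?S. ?g p = k}. a (fst p) * b (snd p) * of_nat (?g p) powr (- s))"
  proof (rule sum.group[symmetric])
    show "?g ` ?S \<subseteq> {1..N*M}"
      by (auto intro: mult_le_mono simp: Suc_le_eq)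
  qed auto
  also have "\<dots> = dpoly (\<lambda>k. \<Sum>p\<in>{p\<in>?S. ?g p = k}. a (fst p) * b (snd p)) (N * M) s"
    unfolding dpoly_def sum_distrib_right by (intro sum.cong refl) auto
  finally show "dpoly a N s * dpoly b M s = dpoly (\<lambda>k. \<Sum>p\<in>{p\<in>?S. ?g p = k}. a (fst p) * b (snd p)) (N * M) s" .
qed

lemma dpoly_bounded: "s \<in> half_plane 0 \<Longrightarrow> cmod (dpoly a N s) \<le> (\<Sum>n=1..N. cmod (a n))"
  unfolding dpoly_def
proof (rule order.trans[OF norm_sum], rule sum_mono)
  fix n assume s: "s \<in> half_plane 0" and n: "n \<in> {1..N}"
  have "real n powr (- Re s) \<le> 1 powr (- Re s)"
    by (rule powr_mono2') (use s n in \<open>auto simp: half_plane_def\<close>)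
  then show "norm (a n * of_nat n powr (- s)) \<le> cmod (a n)"
    using n by (simp add: norm_mult cmod_nat_powr mult_left_le)
qed

text \<open>
  This class of functions contains the Dirichlet series \<open>\<psi>\<close> of a symbol and is an algebra closed
  under \<open>exp\<close>, hence contains \<open>n\<^sup>-\<^sup>\<phi> = n\<^sup>-\<^sup>c\<^sup>0\<^sup>s exp (- \<psi> ln n)\<close>.
\<close>

definition unif_dirichlet :: "(complex \<Rightarrow> complex) \<Rightarrow> bool" where
  "unif_dirichlet F \<longleftrightarrow> (\<forall>e>0. \<forall>d>0. \<exists>a N. \<forall>s\<in>half_plane e. cmod (F s - dpoly a N s) \<le> d)"

lemma unif_dirichletD:
  assumes "unif_dirichlet F" "e > 0" "d > 0"
  shows "\<exists>a N. \<forall>s\<in>half_plane e. cmod (F s - dpoly a N s) \<le> d"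
  using assms unfolding unif_dirichlet_def by blast

lemma unif_dirichlet_bounded:
  assumes "unif_dirichlet F" "e > 0"
  shows "\<exists>B>0. \<forall>s\<in>half_plane e. cmod (F s) \<le> B"
proof -
  obtain a N where a: "\<forall>s\<in>half_plane e. cmod (F s - dpoly a N s) \<le> 1"
    using unif_dirichletD[OF assms, of 1] by auto
  show ?thesis
  proof (intro exI conjI ballI)
    show "1 + (\<Sum>n=1..N. cmod (a n)) > 0"
      by (simp add: add_pos_nonneg sum_nonneg)
    fix s assume s: "s \<in> half_plane e"
    show "cmod (F s) \<le> 1 + (\<Sum>n=1..N. cmod (a n))"
      using a[rule_format, OF s] dpoly_bounded[OF Re_half_plane_pos[OF s assms(2)], of a N]
        norm_triangle_ineq[of "F s - dpoly a N s" "dpoly a N s"] by simp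
  qed
qed

lemma unif_dirichlet_cong:
  assumes "unif_dirichlet F" "\<And>s. s \<in> half_plane 0 \<Longrightarrow> F s = G s"
  shows "unif_dirichlet G"
proof -
  have "F s = G s" if "s \<in> half_plane e" "e > 0" for s e
    using assms(2)[OF Re_half_plane_pos[OF that]] .
  then show ?thesis using assms(1) unfolding unif_dirichlet_def by simp
qed

lemma unif_dirichlet_monomial:
  assumes "n \<ge> 1" shows "unif_dirichlet (\<lambda>s. c * of_nat n powr (- s))"
proof -
  have "dpoly (\<lambda>k. if k = n then c else 0) n s = c * of_nat n powr (- s)" for s
  proof -
    have "dpoly (\<lambda>k. if k = n then c else 0) n s = (\<Sum>k=1..n. if k = n then c * of_nat n powr (- s) else 0)"
      unfolding dpoly_def by (intro sum.cong) auto
    then show ?thesis using assms by simp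
  qed
  then have "\<forall>s\<in>half_plane e. cmod (c * of_nat n powr (- s) - dpoly (\<lambda>k. if k = n then c else 0) n s) \<le> d"
    if "d > 0" for e d :: real using that by simp
  then show ?thesis unfolding unif_dirichlet_def by blast
qed

lemma unif_dirichlet_const: "unif_dirichlet (\<lambda>s. c)"
  using unif_dirichlet_monomial[of 1 c] by simp

lemma unif_dirichlet_add:
  assumes F: "unif_dirichlet F" and G: "unif_dirichlet G"
  shows "unif_dirichlet (\<lambda>s. F s + G s)"
  unfolding unif_dirichlet_def
proof (intro allI impI)
  fix e d :: real assume e: "e > 0" and d: "d > 0"
  obtain a N where a: "\<forall>s\<in>half_plane e. cmod (F s - dpoly a N s) \<le> d / 2"
    using unif_dirichletD[OF F e, of "d/2"] d by auto
  obtain b M where b: "\<forall>s\<in>half_plane e. cmod (G s - dpoly b M s) \<le> d / 2"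
    using unif_dirichletD[OF G e, of "d/2"] d by auto
  obtain c K where c: "\<forall>s. dpoly a N s + dpoly b M s = dpoly c K s"
    using dpoly_add_ex by blast
  have "cmod (F s + G s - dpoly c K s) \<le> d" if s: "s \<in> half_plane e" for s
  proof -
    have "F s + G s - dpoly c K s = (F s - dpoly a N s) + (G s - dpoly b M s)"
      unfolding c[rule_format, symmetric] by (simp only: add_diff_add)
    also have "cmod \<dots> \<le> d / 2 + d / 2"
      by (rule norm_triangle_mono) (use a b s in blast)+
    finally show ?thesis by simp
  qed
  then show "\<exists>a N. \<forall>s\<in>half_plane e. cmod (F s + G s - dpoly a N s) \<le> d" by blast
qed

lemma unif_dirichlet_mult:
  assumes F: "unif_dirichlet F" and G: "unif_dirichlet G"
  shows "unif_dirichlet (\<lambda>s. F s * G s)"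
  unfolding unif_dirichlet_def
proof (intro allI impI)
  fix e d :: real assume e: "e > 0" and d: "d > 0"
  obtain B where B: "B > 0" "\<forall>s\<in>half_plane e. cmod (G s) \<le> B"
    using unif_dirichlet_bounded[OF G e] by blast
  have "d / (2 * B) > 0" using d B(1) by simp
  then obtain a N where a: "\<forall>s\<in>half_plane e. cmod (F s - dpoly a N s) \<le> d / (2 * B)"
    using unif_dirichletD[OF F e] by blast
  define A where "A = (\<Sum>n=1..N. cmod (a n)) + 1"
  have A: "A > 0" by (simp add: A_def add_nonneg_pos sum_nonneg)
  have "d / (2 * A) > 0" using d A by simp
  then obtain b M where b: "\<forall>s\<in>half_plane e. cmod (G s - dpoly b M s) \<le> d / (2 * A)"
    using unif_dirichletD[OF G e] by blast
  obtain c K where c: "\<forall>s. dpoly a N s * dpoly b M s = dpoly c K s"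
    using dpoly_mult_ex by blast
  have "cmod (F s * G s - dpoly c K s) \<le> d" if s: "s \<in> half_plane e" for s
  proof -
    have "F s * G s - dpoly c K s = (F s - dpoly a N s) * G s + dpoly a N s * (G s - dpoly b M s)"
      unfolding c[rule_format, symmetric] by (simp add: algebra_simps)
    also have "cmod \<dots> \<le> cmod (F s - dpoly a N s) * cmod (G s) + cmod (dpoly a N s) * cmod (G s - dpoly b M s)"
      by (rule order.trans[OF norm_triangle_ineq]) (simp add: norm_mult)
    also have "\<dots> \<le> d / (2 * B) * B + A * (d / (2 * A))"
    proof (intro add_mono mult_mono)
      show "cmod (dpoly a N s) \<le> A"
        using dpoly_bounded[OF Re_half_plane_pos[OF s e], of a N] by (simp add: A_def)
    qed (use a[rule_format, OF s] b[rule_format, OF s] B(2)[rule_format, OF s] A B(1) d in simp_all)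
    also have "\<dots> = d" using A B(1) by simp
    finally show ?thesis .
  qed
  then show "\<exists>a N. \<forall>s\<in>half_plane e. cmod (F s * G s - dpoly a N s) \<le> d" by blast
qed

lemma unif_dirichlet_sum:
  "(\<And>i. i \<in> I \<Longrightarrow> unif_dirichlet (F i)) \<Longrightarrow> unif_dirichlet (\<lambda>s. \<Sum>i\<in>I. F i s)"
  by (induction I rule: infinite_finite_induct) (auto intro: unif_dirichlet_const unif_dirichlet_add)

lemma unif_dirichlet_power: "unif_dirichlet F \<Longrightarrow> unif_dirichlet (\<lambda>s. F s ^ k)"
  by (induction k) (auto intro: unif_dirichlet_const unif_dirichlet_mult)

lemma unif_dirichlet_exp:
  assumes F: "unif_dirichlet F"
  shows "unif_dirichlet (\<lambda>s. exp (F s))"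
  unfolding unif_dirichlet_def
proof (intro allI impI)
  fix e d :: real assume e: "e > 0" and d: "d > 0"
  obtain B where B: "B > 0" "\<forall>s\<in>half_plane e. cmod (F s) \<le> B"
    using unif_dirichlet_bounded[OF F e] by blast
  have "(\<lambda>n. exp B * B * (B ^ n / fact n)) \<longlonglongrightarrow> exp B * B * 0"
    using summable_LIMSEQ_zero[OF summable_exp_generic[of B]]
    by (intro tendsto_intros) (simp add: field_simps)
  then have "\<forall>\<^sub>F n in sequentially. exp B * B * (B ^ n / fact n) < d / 2"
    using d by (intro order_tendstoD) auto
  then obtain n where n: "exp B * B * (B ^ n / fact n) < d / 2"
    by (auto simp: eventually_sequentially)
  have "unif_dirichlet (\<lambda>s. \<Sum>i\<le>n. (1 / fact i) * F s ^ i)"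
    by (intro unif_dirichlet_sum unif_dirichlet_mult unif_dirichlet_power unif_dirichlet_const F)
  moreover have "d / 2 > 0" using d by simp
  ultimately obtain a N where a: "\<forall>s\<in>half_plane e. cmod ((\<Sum>i\<le>n. (1 / fact i) * F s ^ i) - dpoly a N s) \<le> d / 2"
    using unif_dirichletD[OF _ e] by blast
  have "cmod (exp (F s) - dpoly a N s) \<le> d" if s: "s \<in> half_plane e" for s
  proof -
    have "cmod (exp (F s) - (\<Sum>i\<le>n. F s ^ i / fact i)) \<le> exp \<bar>Re (F s)\<bar> * cmod (F s) ^ Suc n / fact n"
      by (rule Taylor_exp)
    also have "\<dots> \<le> exp B * B ^ Suc n / fact n"
      using B(2)[rule_format, OF s] abs_Re_le_cmod[of "F s"] B(1)
      by (intro divide_right_mono mult_mono power_mono) auto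
    also have "\<dots> = exp B * B * (B ^ n / fact n)" by simp
    also have "\<dots> \<le> d / 2" using n by (rule less_imp_le)
    also have "(\<Sum>i\<le>n. F s ^ i / fact i) = (\<Sum>i\<le>n. (1 / fact i) * F s ^ i)" by simp
    finally have "cmod (exp (F s) - (\<Sum>i\<le>n. (1 / fact i) * F s ^ i)) \<le> d / 2" .
    then show ?thesis using a[rule_format, OF s] norm_triangle_ineq[of "exp (F s) - (\<Sum>i\<le>n. (1 / fact i) * F s ^ i)" "(\<Sum>i\<le>n. (1 / fact i) * F s ^ i) - dpoly a N s"]
      by simp
  qed
  then show "\<exists>a N. \<forall>s\<in>half_plane e. cmod (exp (F s) - dpoly a N s) \<le> d" by blast
qed

section \<open>Means along vertical lines\<close>

text \<open>
  Means are taken over an arithmetic progression on a vertical line, so that they are finite sums.  The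
  step must not resonate with any of the countably many frequencies \<open>ln m - ln n \<noteq> 0\<close>, each of which
  excludes only countably many steps.
\<close>

lemma ex_sampling_step:
  "\<exists>h::real. \<forall>m n::nat. m \<ge> 1 \<longrightarrow> n \<ge> 1 \<longrightarrow> m \<noteq> n \<longrightarrow> exp (- (\<i> * of_real (h * (ln (real m) - ln (real n))))) \<noteq> 1"
proof -
  define bad where "bad = (\<Union>m::nat. \<Union>n::nat. \<Union>j::int. {of_int (2 * j) * pi / (ln (real m) - ln (real n))})"
  have "countable bad" unfolding bad_def by (intro countable_UN) auto
  then obtain h where h: "h \<notin> bad"
    using uncountable_UNIV_real by (metis UNIV_eq_I)
  have "exp (- (\<i> * of_real (h * (ln (real m) - ln (real n))))) \<noteq> 1" if "m \<ge> 1" "n \<ge> 1" "m \<noteq> n" for m n :: nat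
  proof
    assume "exp (- (\<i> * of_real (h * (ln (real m) - ln (real n))))) = 1"
    then obtain j :: int where j: "- (h * (ln (real m) - ln (real n))) = of_int (2 * j) * pi"
      by (auto simp: exp_eq_1)
    have "ln (real m) - ln (real n) \<noteq> 0" using that by simp
    then have "h = of_int (2 * (- j)) * pi / (ln (real m) - ln (real n))"
      using j by (simp add: field_simps)
    with h show False unfolding bad_def by blast
  qed
  then show ?thesis by blast
qed

definition sampling_step :: real where
  "sampling_step = (SOME h. \<forall>m n::nat. m \<ge> 1 \<longrightarrow> n \<ge> 1 \<longrightarrow> m \<noteq> n \<longrightarrow>
     exp (- (\<i> * of_real (h * (ln (real m) - ln (real n))))) \<noteq> 1)"

lemma sampling_step:
  "m \<ge> 1 \<Longrightarrow> n \<ge> 1 \<Longrightarrow> m \<noteq> n \<Longrightarrow>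
    exp (- (\<i> * of_real (sampling_step * (ln (real m) - ln (real n))))) \<noteq> 1"
  using someI_ex[OF ex_sampling_step] unfolding sampling_step_def by blast

definition vmean :: "real \<Rightarrow> (complex \<Rightarrow> 'a::real_normed_vector) \<Rightarrow> nat \<Rightarrow> 'a" where
  "vmean \<sigma> F K = (\<Sum>k<K. F (Complex \<sigma> (sampling_step * real k))) /\<^sub>R real K"

lemma vmean_add: "vmean \<sigma> (\<lambda>s. F s + G s) K = vmean \<sigma> F K + vmean \<sigma> G K"
  by (simp add: vmean_def sum.distrib scaleR_add_right)

lemma vmean_sum: "vmean \<sigma> (\<lambda>s. \<Sum>i\<in>I. F i s) K = (\<Sum>i\<in>I. vmean \<sigma> (F i) K)"
  unfolding vmean_def by (subst sum.swap) (simp add: scaleR_sum_right)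

lemma vmean_mult_left:
  fixes F :: "complex \<Rightarrow> 'a::real_normed_algebra"
  shows "vmean \<sigma> (\<lambda>s. c * F s) K = c * vmean \<sigma> F K"
  by (simp add: vmean_def sum_distrib_left)

lemma vmean_of_real: "vmean \<sigma> (\<lambda>s. of_real (U s) :: complex) K = of_real (vmean \<sigma> U K)"
  by (simp add: vmean_def scaleR_conv_of_real)

lemma vmean_cnj: "vmean \<sigma> (\<lambda>s. cnj (F s)) K = cnj (vmean \<sigma> F K)"
  by (simp add: vmean_def scaleR_conv_of_real)

lemma vmean_cong: "(\<And>s. Re s = \<sigma> \<Longrightarrow> F s = G s) \<Longrightarrow> vmean \<sigma> F = vmean \<sigma> G"
  by (rule ext) (simp add: vmean_def)

lemma vmean_mono:
  fixes F G :: "complex \<Rightarrow> real"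
  shows "(\<And>s. Re s = \<sigma> \<Longrightarrow> F s \<le> G s) \<Longrightarrow> vmean \<sigma> F K \<le> vmean \<sigma> G K"
  unfolding vmean_def by (intro scaleR_left_mono sum_mono) auto

lemma norm_vmean_le:
  assumes "\<And>s. Re s = \<sigma> \<Longrightarrow> norm (F s) \<le> d" "d \<ge> 0"
  shows "norm (vmean \<sigma> F K) \<le> d"
proof -
  have "norm (\<Sum>k<K. F (Complex \<sigma> (sampling_step * real k))) \<le> of_nat (card {..<K}) * d"
    by (rule sum_norm_bound) (simp add: assms)
  then show ?thesis using assms(2) by (cases "K = 0") (auto simp: vmean_def field_simps)
qed

lemma vmean_const: "(\<lambda>K. vmean \<sigma> (\<lambda>s. c) K) \<longlonglongrightarrow> c"
proof (rule tendsto_eventually)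
  show "\<forall>\<^sub>F K in sequentially. vmean \<sigma> (\<lambda>s. c) K = c"
    using eventually_gt_at_top[of 0]
    by eventually_elim (simp add: vmean_def sum_constant_scaleR)
qed

lemma vmean_approx_zero:
  assumes "\<And>d. d > 0 \<Longrightarrow> \<exists>G. (\<forall>s. Re s = \<sigma> \<longrightarrow> norm (F s - G s) \<le> d) \<and> vmean \<sigma> G \<longlonglongrightarrow> 0"
  shows "vmean \<sigma> F \<longlonglongrightarrow> 0"
proof (rule LIMSEQ_I)
  fix r :: real assume "r > 0"
  then obtain G where G: "\<forall>s. Re s = \<sigma> \<longrightarrow> norm (F s - G s) \<le> r / 2" "vmean \<sigma> G \<longlonglongrightarrow> 0"
    using assms[of "r / 2"] by auto
  obtain K0 where K0: "\<forall>K\<ge>K0. norm (vmean \<sigma> G K - 0) < r / 2"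
    using LIMSEQ_D[OF G(2), of "r / 2"] \<open>r > 0\<close> by auto
  have "norm (vmean \<sigma> F K - 0) < r" if "K \<ge> K0" for K
  proof -
    have "vmean \<sigma> F K = vmean \<sigma> (\<lambda>s. F s - G s) K + vmean \<sigma> G K"
      by (simp add: vmean_add[symmetric])
    moreover have "norm (vmean \<sigma> (\<lambda>s. F s - G s) K) \<le> r / 2"
      using G(1) \<open>r > 0\<close> by (intro norm_vmean_le) auto
    ultimately show ?thesis
      using K0 that norm_triangle_ineq[of "vmean \<sigma> (\<lambda>s. F s - G s) K" "vmean \<sigma> G K"] by force
  qed
  then show "\<exists>K0. \<forall>K\<ge>K0. norm (vmean \<sigma> F K - 0) < r" by blast
qed

text \<open>
  A geometric series with ratio of modulus one, and different from one by the choice of the step.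
\<close>

lemma vmean_exp_zero:
  assumes "m \<ge> 1" "n \<ge> 1" "m \<noteq> n"
  shows "vmean \<sigma> (\<lambda>s. exp (- (s * complex_of_real (ln (real m) - ln (real n))))) \<longlonglongrightarrow> 0"
proof -
  define L where "L = ln (real m) - ln (real n)"
  define z where "z = exp (- (\<i> * complex_of_real (sampling_step * L)))"
  have z: "z \<noteq> 1" "cmod z = 1" using sampling_step[OF assms] by (auto simp: z_def L_def)
  define c where "c = exp (- complex_of_real (\<sigma> * L))"
  have "exp (- (Complex \<sigma> (sampling_step * real k) * complex_of_real L)) = c * z ^ k" for k
    by (simp add: c_def z_def exp_of_nat_mult[symmetric] exp_add[symmetric] Complex_eq algebra_simps)
  then have eq: "vmean \<sigma> (\<lambda>s. exp (- (s * complex_of_real L))) K = (c * ((z ^ K - 1) / (z - 1))) /\<^sub>R real K" for K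
    using z by (simp add: vmean_def sum_distrib_left[symmetric] geometric_sum)
  have bd: "cmod (c * ((z ^ K - 1) / (z - 1))) \<le> cmod c * (2 / cmod (z - 1))" for K
  proof -
    have "cmod (z ^ K - 1) \<le> cmod (z ^ K) + cmod 1" by (rule norm_triangle_ineq4)
    then have "cmod (z ^ K - 1) \<le> 2" using z by (simp add: norm_power)
    then show ?thesis by (simp add: norm_mult norm_divide divide_right_mono mult_left_mono)
  qed
  have "vmean \<sigma> (\<lambda>s. exp (- (s * complex_of_real L))) \<longlonglongrightarrow> 0"
  proof (rule Lim_null_comparison)
    show "\<forall>\<^sub>F K in sequentially. norm (vmean \<sigma> (\<lambda>s. exp (- (s * complex_of_real L))) K)
        \<le> inverse (real K) * (cmod c * (2 / cmod (z - 1)))"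
    proof (intro always_eventually allI)
      fix K
      show "norm (vmean \<sigma> (\<lambda>s. exp (- (s * complex_of_real L))) K) \<le> inverse (real K) * (cmod c * (2 / cmod (z - 1)))"
        unfolding eq norm_scaleR using mult_left_mono[OF bd, of "inverse (real K)" K] by simp
    qed
    show "(\<lambda>K. inverse (real K) * (cmod c * (2 / cmod (z - 1)))) \<longlonglongrightarrow> 0"
      by (intro tendsto_mult_left_zero lim_inverse_n)
  qed
  then show ?thesis by (simp add: L_def)
qed

text \<open>
  With \<open>L = ln m - ln n > 0\<close> the function is \<open>e\<^sup>-\<^sup>L\<^sup>c\<^sup>0\<^sup>s e\<^sup>-\<^sup>L\<^sup>\<psi>\<close>.  The second factor is close to a Dirichlet
  polynomial, and its monomials \<open>k\<^sup>-\<^sup>s\<close> turn into \<open>(m\<^sup>c\<^sup>0 k / n\<^sup>c\<^sup>0)\<^sup>-\<^sup>s\<close>, of nonzero frequency since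
  \<open>m\<^sup>c\<^sup>0 > n\<^sup>c\<^sup>0\<close>.  Here the characteristic has to be positive.
\<close>

lemma vmean_pairing_zero:
  assumes \<psi>: "unif_dirichlet \<psi>" and \<phi>: "\<And>s. s \<in> half_plane 0 \<Longrightarrow> \<phi> s = of_nat c0 * s + \<psi> s"
    and "c0 \<ge> 1" "\<sigma> > 0" and mn: "1 \<le> n" "n < m"
  shows "vmean \<sigma> (\<lambda>s. pairing_kernel m n (\<phi> s)) \<longlonglongrightarrow> 0"
proof (rule vmean_approx_zero)
  define L where "L = ln (real m) - ln (real n)"
  have L: "L > 0" using mn by (simp add: L_def)
  fix d :: real assume d: "d > 0"
  have "unif_dirichlet (\<lambda>s. exp ((- of_real L) * \<psi> s))"
    by (intro unif_dirichlet_exp unif_dirichlet_mult unif_dirichlet_const \<psi>)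
  moreover have "\<sigma> / 2 > 0" using \<open>\<sigma> > 0\<close> by simp
  ultimately obtain b M where b: "\<forall>s\<in>half_plane (\<sigma>/2). cmod (exp ((- of_real L) * \<psi> s) - dpoly b M s) \<le> d"
    using unif_dirichletD[OF _ _ d] by blast
  define G where "G s = exp (- (s * of_real (of_nat c0 * L))) * dpoly b M s" for s
  have "cmod (pairing_kernel m n (\<phi> s) - G s) \<le> d" if s: "Re s = \<sigma>" for s
  proof -
    have hp: "s \<in> half_plane 0" "s \<in> half_plane (\<sigma>/2)" using s \<open>\<sigma> > 0\<close> by (auto simp: half_plane_def)
    have "pairing_kernel m n (\<phi> s) = exp (- (s * of_real (of_nat c0 * L))) * exp ((- of_real L) * \<psi> s)"
      using pairing_kernel_less[OF mn] \<phi>[OF hp(1)]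
      by (simp add: L_def exp_add[symmetric] algebra_simps)
    then have "cmod (pairing_kernel m n (\<phi> s) - G s) = exp (- (\<sigma> * (of_nat c0 * L))) * cmod (exp ((- of_real L) * \<psi> s) - dpoly b M s)"
      using s by (simp add: G_def right_diff_distrib[symmetric] norm_mult)
    also have "\<dots> \<le> 1 * d"
      using L \<open>\<sigma> > 0\<close> b[rule_format, OF hp(2)] by (intro mult_mono) auto
    finally show ?thesis by simp
  qed
  moreover have "vmean \<sigma> G \<longlonglongrightarrow> 0"
  proof -
    have eq: "G s = (\<Sum>k=1..M. b k * exp (- (s * complex_of_real (ln (real (m ^ c0 * k)) - ln (real (n ^ c0))))))" for s
      unfolding G_def dpoly_def sum_distrib_left
    proof (intro sum.cong refl)
      fix k assume k: "k \<in> {1..M}"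
      have "ln (real (m ^ c0 * k)) - ln (real (n ^ c0)) = real c0 * L + ln (real k)"
        using k mn by (simp add: ln_mult ln_realpow L_def algebra_simps)
      then show "exp (- (s * of_real (of_nat c0 * L))) * (b k * of_nat k powr (- s)) =
          b k * exp (- (s * complex_of_real (ln (real (m ^ c0 * k)) - ln (real (n ^ c0)))))"
        using k by (simp add: nat_powr_exp exp_add[symmetric] algebra_simps)
    qed
    have "vmean \<sigma> (\<lambda>s. exp (- (s * complex_of_real (ln (real (m ^ c0 * k)) - ln (real (n ^ c0)))))) \<longlonglongrightarrow> 0"
      if k: "k \<in> {1..M}" for k
    proof (rule vmean_exp_zero)
      have "n ^ c0 < m ^ c0" using mn \<open>c0 \<ge> 1\<close> by (simp add: power_strict_mono)
      also have "\<dots> \<le> m ^ c0 * k" using k by simp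
      finally show "m ^ c0 * k \<noteq> n ^ c0" by simp
    qed (use mn k in \<open>auto simp: Suc_le_eq\<close>)
    then have "(\<lambda>K. \<Sum>k=1..M. b k * vmean \<sigma> (\<lambda>s. exp (- (s * complex_of_real (ln (real (m ^ c0 * k)) - ln (real (n ^ c0)))))) K) \<longlonglongrightarrow> (\<Sum>k=1..M. b k * 0)"
      by (intro tendsto_intros)
    moreover have "vmean \<sigma> G = (\<lambda>K. \<Sum>k=1..M. b k * vmean \<sigma> (\<lambda>s. exp (- (s * complex_of_real (ln (real (m ^ c0 * k)) - ln (real (n ^ c0)))))) K)"
      unfolding eq vmean_sum vmean_mult_left by (rule refl)
    ultimately show ?thesis by simp
  qed
  ultimately show "\<exists>G. (\<forall>s. Re s = \<sigma> \<longrightarrow> cmod (pairing_kernel m n (\<phi> s) - G s) \<le> d) \<and> vmean \<sigma> G \<longlonglongrightarrow> 0"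
    by blast
qed

lemma vmean_pairing:
  assumes "unif_dirichlet \<psi>" "\<And>s. s \<in> half_plane 0 \<Longrightarrow> \<phi> s = of_nat c0 * s + \<psi> s"
    and "c0 \<ge> 1" "\<sigma> > 0" and mn: "1 \<le> m" "1 \<le> n"
  shows "vmean \<sigma> (\<lambda>s. pairing_kernel m n (\<phi> s)) \<longlonglongrightarrow> (if m = n then 1 else 0)"
proof -
  consider "m = n" | "n < m" | "m < n" by linarith
  then show ?thesis
  proof cases
    case 1 then show ?thesis using mn vmean_const[of \<sigma> 1] by (simp add: pairing_kernel_diag)
  next
    case 2 then show ?thesis using vmean_pairing_zero[OF assms(1-4) mn(2)] by simp
  next
    case 3
    have "(\<lambda>K. cnj (vmean \<sigma> (\<lambda>s. pairing_kernel n m (\<phi> s)) K)) \<longlonglongrightarrow> cnj 0"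
      by (intro tendsto_intros vmean_pairing_zero[OF assms(1-4) mn(1) 3])
    moreover have "vmean \<sigma> (\<lambda>s. pairing_kernel m n (\<phi> s)) = (\<lambda>K. cnj (vmean \<sigma> (\<lambda>s. pairing_kernel n m (\<phi> s)) K))"
      by (rule ext) (simp only: pairing_kernel_swap[of m n] vmean_cnj)
    ultimately show ?thesis using 3 by simp
  qed
qed

lemma vmean_majorant:
  assumes "unif_dirichlet \<psi>" "\<And>s. s \<in> half_plane 0 \<Longrightarrow> \<phi> s = of_nat c0 * s + \<psi> s"
    and "c0 \<ge> 1" "\<sigma> > 0"
  shows "vmean \<sigma> (\<lambda>s. majorant a N (\<phi> s)) \<longlonglongrightarrow> (\<Sum>n=1..N. (cmod (a n))\<^sup>2)"
proof -
  have "(\<lambda>K. complex_of_real (vmean \<sigma> (\<lambda>s. majorant a N (\<phi> s)) K)) =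
      (\<lambda>K. \<Sum>m=1..N. \<Sum>n=1..N. a m * cnj (a n) * vmean \<sigma> (\<lambda>s. pairing_kernel m n (\<phi> s)) K)"
    unfolding vmean_of_real[symmetric] majorant_expand vmean_sum vmean_mult_left by (rule refl)
  moreover have "(\<lambda>K. \<Sum>m=1..N. \<Sum>n=1..N. a m * cnj (a n) * vmean \<sigma> (\<lambda>s. pairing_kernel m n (\<phi> s)) K)
     \<longlonglongrightarrow> (\<Sum>m=1..N. \<Sum>n=1..N. a m * cnj (a n) * (if m = n then 1 else 0))"
    by (intro tendsto_sum tendsto_mult_left vmean_pairing[OF assms]) auto
  moreover have "(\<Sum>m=1..N. \<Sum>n=1..N. a m * cnj (a n) * (if m = n then 1 else 0)) = complex_of_real (\<Sum>n=1..N. (cmod (a n))\<^sup>2)"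
    unfolding of_real_sum complex_norm_square by (simp add: if_distrib cong: if_cong)
  ultimately have "(\<lambda>K. complex_of_real (vmean \<sigma> (\<lambda>s. majorant a N (\<phi> s)) K)) \<longlonglongrightarrow> complex_of_real (\<Sum>n=1..N. (cmod (a n))\<^sup>2)"
    by (simp only:)
  then show ?thesis by (rule tendsto_of_real_iff[THEN iffD1])
qed

text \<open>
  On the line \<open>Re s = \<sigma>\<close> the product \<open>m\<^sup>-\<^sup>s cnj (n\<^sup>-\<^sup>s)\<close> is a constant multiple of the pairing kernel, so this is
  orthogonality of the monomials.
\<close>

lemma vmean_dpoly_sq:
  assumes "\<sigma> > 0"
  shows "vmean \<sigma> (\<lambda>s. (cmod (dpoly a N s))\<^sup>2) \<longlonglongrightarrow> (\<Sum>n=1..N. (cmod (a n))\<^sup>2 * real n powr (- 2 * \<sigma>))"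
proof -
  define w where "w m n = a m * cnj (a n) * of_real (real (min m n) powr (- 2 * \<sigma>))" for m n
  have "vmean \<sigma> (\<lambda>s. complex_of_real ((cmod (dpoly a N s))\<^sup>2)) =
    vmean \<sigma> (\<lambda>s. \<Sum>m=1..N. \<Sum>n=1..N. w m n * pairing_kernel m n s)"
  proof (rule vmean_cong)
    fix s assume s: "Re s = \<sigma>"
    have "complex_of_real ((cmod (dpoly a N s))\<^sup>2) = (\<Sum>m=1..N. \<Sum>n=1..N. (a m * of_nat m powr (- s)) * cnj (a n * of_nat n powr (- s)))"
      by (simp only: complex_norm_square dpoly_def cnj_sum sum_product)
    also have "\<dots> = (\<Sum>m=1..N. \<Sum>n=1..N. w m n * pairing_kernel m n s)"
    proof (intro sum.cong refl)
      fix m n assume "m \<in> {1..N}" "n \<in> {1..N}"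
      then have "real (min m n) powr (- 2 * \<sigma>) * real (min m n) powr (2 * \<sigma>) = 1"
        by (subst powr_add[symmetric]) auto
      then have "complex_of_real (real (min m n) powr (- 2 * \<sigma>)) * of_real (real (min m n) powr (2 * \<sigma>)) = 1"
        by (simp only: of_real_mult[symmetric] of_real_1)
      then show "(a m * of_nat m powr (- s)) * cnj (a n * of_nat n powr (- s)) = w m n * pairing_kernel m n s"
        unfolding w_def pairing_kernel_def s by (simp add: mult_ac)
    qed
    finally show "complex_of_real ((cmod (dpoly a N s))\<^sup>2) = (\<Sum>m=1..N. \<Sum>n=1..N. w m n * pairing_kernel m n s)" .
  qed
  moreover have "(\<lambda>K. vmean \<sigma> (\<lambda>s. \<Sum>m=1..N. \<Sum>n=1..N. w m n * pairing_kernel m n s) K)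
     \<longlonglongrightarrow> (\<Sum>m=1..N. \<Sum>n=1..N. w m n * (if m = n then 1 else 0))"
    unfolding vmean_sum vmean_mult_left
    by (intro tendsto_sum tendsto_mult_left vmean_pairing[where ?c0.0 = 1 and \<psi> = "\<lambda>s. 0"])
      (use assms in \<open>auto intro: unif_dirichlet_const\<close>)
  moreover have "(\<Sum>m=1..N. \<Sum>n=1..N. w m n * (if m = n then 1 else 0)) = complex_of_real (\<Sum>n=1..N. (cmod (a n))\<^sup>2 * real n powr (- 2 * \<sigma>))"
    unfolding of_real_sum of_real_mult complex_norm_square by (simp add: if_distrib w_def cong: if_cong)
  ultimately have "(\<lambda>K. complex_of_real (vmean \<sigma> (\<lambda>s. (cmod (dpoly a N s))\<^sup>2) K)) \<longlonglongrightarrow> complex_of_real (\<Sum>n=1..N. (cmod (a n))\<^sup>2 * real n powr (- 2 * \<sigma>))"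
    by (simp only: vmean_of_real[symmetric])
  then show ?thesis by (rule tendsto_of_real_iff[THEN iffD1])
qed

lemma vmean_LIMSEQ_mono:
  fixes F G :: "complex \<Rightarrow> real"
  assumes "\<And>s. Re s = \<sigma> \<Longrightarrow> F s \<le> G s" "vmean \<sigma> F \<longlonglongrightarrow> x" "vmean \<sigma> G \<longlonglongrightarrow> y"
  shows "x \<le> y"
  by (rule LIMSEQ_le[OF assms(2,3)]) (use vmean_mono[of \<sigma> F G] assms(1) in blast)

lemma vmean_LIMSEQ_mult:
  fixes F :: "complex \<Rightarrow> real"
  assumes "vmean \<sigma> F \<longlonglongrightarrow> x"
  shows "vmean \<sigma> (\<lambda>s. c * F s) \<longlonglongrightarrow> c * x"
proof -
  have "vmean \<sigma> (\<lambda>s. c * F s) = (\<lambda>K. c * vmean \<sigma> F K)"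
    by (rule ext) (rule vmean_mult_left)
  with tendsto_mult_left[OF assms, of c] show ?thesis by (rule ssubst[rotated])
qed

lemma vmean_LIMSEQ_add:
  assumes "vmean \<sigma> F \<longlonglongrightarrow> x" "vmean \<sigma> G \<longlonglongrightarrow> y"
  shows "vmean \<sigma> (\<lambda>s. F s + G s) \<longlonglongrightarrow> x + y"
proof -
  have "vmean \<sigma> (\<lambda>s. F s + G s) = (\<lambda>K. vmean \<sigma> F K + vmean \<sigma> G K)"
    by (rule ext) (rule vmean_add)
  with tendsto_add[OF assms] show ?thesis by (rule ssubst[rotated])
qed

section \<open>Evaluation of square-summable Dirichlet series\<close>

lemma dpoly_coeff_bound:
  assumes "\<sigma> > 0" "\<And>s. Re s = \<sigma> \<Longrightarrow> cmod (dpoly b K s) \<le> d"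
  shows "(\<Sum>n=1..K. (cmod (b n))\<^sup>2 * real n powr (- 2 * \<sigma>)) \<le> d\<^sup>2"
proof (rule vmean_LIMSEQ_mono)
  show "(cmod (dpoly b K s))\<^sup>2 \<le> d\<^sup>2" if "Re s = \<sigma>" for s
    using assms(2)[OF that] by (intro power_mono) auto
qed (use vmean_dpoly_sq[OF assms(1)] vmean_const in auto)

lemma dpoly_Cauchy_Schwarz:
  "(cmod (dpoly b K s))\<^sup>2 \<le>
    (\<Sum>n=1..K. (cmod (b n))\<^sup>2 * real n powr (- 2 * \<sigma>)) * (\<Sum>n=1..K. real n powr (- 2 * (Re s - \<sigma>)))"
proof -
  have "cmod (dpoly b K s) \<le> (\<Sum>n=1..K. (cmod (b n) * real n powr (- \<sigma>)) * real n powr (- (Re s - \<sigma>)))"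
    unfolding dpoly_def
  proof (rule order.trans[OF norm_sum], rule sum_mono)
    fix n assume n: "n \<in> {1..K}"
    have "real n powr (- \<sigma>) * real n powr (- (Re s - \<sigma>)) = real n powr (- Re s)"
      using n by (simp add: powr_add[symmetric])
    then show "cmod (b n * of_nat n powr (- s)) \<le> (cmod (b n) * real n powr (- \<sigma>)) * real n powr (- (Re s - \<sigma>))"
      using n by (simp add: norm_mult cmod_nat_powr mult.assoc)
  qed
  then have "(cmod (dpoly b K s))\<^sup>2 \<le> (\<Sum>n=1..K. (cmod (b n) * real n powr (- \<sigma>)) * real n powr (- (Re s - \<sigma>)))\<^sup>2"
    by (intro power_mono) auto
  also have "\<dots> \<le> (\<Sum>n=1..K. (cmod (b n) * real n powr (- \<sigma>))\<^sup>2) * (\<Sum>n=1..K. (real n powr (- (Re s - \<sigma>)))\<^sup>2)"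
    by (rule Cauchy_Schwarz_ineq_sum)
  also have "(\<Sum>n=1..K. (cmod (b n) * real n powr (- \<sigma>))\<^sup>2) = (\<Sum>n=1..K. (cmod (b n))\<^sup>2 * real n powr (- 2 * \<sigma>))"
    by (intro sum.cong refl) (simp add: power_mult_distrib power2_eq_square powr_add[symmetric])
  also have "(\<Sum>n=1..K. (real n powr (- (Re s - \<sigma>)))\<^sup>2) = (\<Sum>n=1..K. real n powr (- 2 * (Re s - \<sigma>)))"
    by (intro sum.cong refl) (simp add: power2_eq_square powr_add[symmetric])
  finally show ?thesis .
qed

lemma sum_powr_le_suminf:
  assumes "x < -1" shows "(\<Sum>n=1..K. real n powr x) \<le> (\<Sum>n. real n powr x)"
  by (rule sum_le_suminf) (use assms summable_real_powr_iff[of x] in auto)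

lemma dirichlet_eval_limit:
  assumes s: "s \<in> half_plane (1/2)"
  shows "(\<lambda>K. dpoly (dcoeff f) K s) \<longlonglongrightarrow> dirichlet_eval f s"
proof -
  let ?t = "\<lambda>n. dcoeff f n * of_nat n powr (- s)"
  have "summable ?t"
  proof (rule summable_comparison_test')
    show "summable (\<lambda>n. (cmod (dcoeff f n))\<^sup>2 + real n powr (- 2 * Re s))"
      using s summable_real_powr_iff[of "- 2 * Re s"]
      by (intro summable_add summable_dcoeff) (auto simp: half_plane_def)
    fix n :: nat assume n: "n \<ge> 1"
    have "cmod (?t n) = cmod (dcoeff f n) * real n powr (- Re s)"
      using n by (simp add: norm_mult cmod_nat_powr)
    also have "\<dots> \<le> 2 * cmod (dcoeff f n) * real n powr (- Re s)" by simp
    also have "\<dots> \<le> (cmod (dcoeff f n))\<^sup>2 + (real n powr (- Re s))\<^sup>2" by (rule sum_squares_bound)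
    also have "(real n powr (- Re s))\<^sup>2 = real n powr (- 2 * Re s)"
      by (simp add: power2_eq_square powr_add[symmetric])
    finally show "cmod (?t n) \<le> (cmod (dcoeff f n))\<^sup>2 + real n powr (- 2 * Re s)" .
  qed
  then have "(\<lambda>K. \<Sum>n<Suc K. ?t n) \<longlonglongrightarrow> dirichlet_eval f s"
    unfolding dirichlet_eval_def by (intro LIMSEQ_Suc summable_LIMSEQ)
  moreover have "(\<Sum>n<Suc K. ?t n) = dpoly (dcoeff f) K s" for K
    unfolding dpoly_def by (rule sum.mono_neutral_right) (auto simp: not_le not_less_eq_eq Suc_le_eq)
  ultimately show ?thesis by simp
qed

lemma dirichlet_eval_add:
  assumes s: "s \<in> half_plane (1/2)"
  shows "dirichlet_eval (f + g) s = dirichlet_eval f s + dirichlet_eval g s"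
proof (rule LIMSEQ_unique)
  show "(\<lambda>K. dpoly (dcoeff (f + g)) K s) \<longlonglongrightarrow> dirichlet_eval (f + g) s"
    by (rule dirichlet_eval_limit[OF s])
  show "(\<lambda>K. dpoly (dcoeff (f + g)) K s) \<longlonglongrightarrow> dirichlet_eval f s + dirichlet_eval g s"
    using tendsto_add[OF dirichlet_eval_limit[OF s, of f] dirichlet_eval_limit[OF s, of g]]
    by (simp add: dpoly_def dcoeff_add sum.distrib algebra_simps)
qed

lemma dirichlet_eval_scaleR:
  assumes s: "s \<in> half_plane (1/2)"
  shows "dirichlet_eval (r *\<^sub>R f) s = r *\<^sub>R dirichlet_eval f s"
proof (rule LIMSEQ_unique)
  show "(\<lambda>K. dpoly (dcoeff (r *\<^sub>R f)) K s) \<longlonglongrightarrow> dirichlet_eval (r *\<^sub>R f) s"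
    by (rule dirichlet_eval_limit[OF s])
  show "(\<lambda>K. dpoly (dcoeff (r *\<^sub>R f)) K s) \<longlonglongrightarrow> r *\<^sub>R dirichlet_eval f s"
    using tendsto_scaleR[OF tendsto_const dirichlet_eval_limit[OF s, of f], of r]
    by (simp add: dpoly_def dcoeff_scaleR scaleR_sum_right)
qed

lemma dirichlet_eval_diff:
  assumes s: "s \<in> half_plane (1/2)"
  shows "dirichlet_eval (f - g) s = dirichlet_eval f s - dirichlet_eval g s"
  using dirichlet_eval_add[OF s, of "f - g" g] by simp

lemma sum_coeff_le_norm: "(\<Sum>n=1..K. (cmod (dcoeff f n))\<^sup>2) \<le> (norm f)\<^sup>2"
proof -
  have "(\<Sum>n=1..K. (cmod (dcoeff f n))\<^sup>2) \<le> (\<Sum>n<Suc K. (cmod (dcoeff f n))\<^sup>2)"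
    by (rule sum_mono2) auto
  then show ?thesis using sum_le_norm_dirichlet_h2_sq[of f "Suc K"] by linarith
qed

lemma dirichlet_eval_bound:
  assumes s: "s \<in> half_plane (1/2)"
  shows "cmod (dirichlet_eval f s) \<le> norm f * sqrt (\<Sum>n. real n powr (- 2 * Re s))"
proof -
  let ?Z = "\<Sum>n. real n powr (- 2 * Re s)"
  have Z: "?Z \<ge> 0"
    using s summable_real_powr_iff[of "- 2 * Re s"] by (intro suminf_nonneg) (auto simp: half_plane_def)
  have "cmod (dpoly (dcoeff f) K s) \<le> norm f * sqrt ?Z" for K
  proof (rule power2_le_imp_le)
    have "(cmod (dpoly (dcoeff f) K s))\<^sup>2 \<le>
        (\<Sum>n=1..K. (cmod (dcoeff f n))\<^sup>2 * real n powr (- 2 * 0)) * (\<Sum>n=1..K. real n powr (- 2 * (Re s - 0)))"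
      by (rule dpoly_Cauchy_Schwarz)
    also have "(\<Sum>n=1..K. (cmod (dcoeff f n))\<^sup>2 * real n powr (- 2 * 0)) = (\<Sum>n=1..K. (cmod (dcoeff f n))\<^sup>2)"
      by (intro sum.cong) auto
    also have "(\<Sum>n=1..K. (cmod (dcoeff f n))\<^sup>2) * (\<Sum>n=1..K. real n powr (- 2 * (Re s - 0))) \<le> (norm f)\<^sup>2 * ?Z"
      using s sum_powr_le_suminf[of "- 2 * Re s" K] sum_coeff_le_norm[of f K]
      by (intro mult_mono) (auto simp: half_plane_def intro!: sum_nonneg)
    finally show "(cmod (dpoly (dcoeff f) K s))\<^sup>2 \<le> (norm f * sqrt ?Z)\<^sup>2"
      using Z by (simp add: power_mult_distrib)
  qed (use Z in simp)
  then show ?thesis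
    by (intro LIMSEQ_le_const2[OF tendsto_norm[OF dirichlet_eval_limit[OF s]]]) auto
qed

definition trunc :: "nat \<Rightarrow> dirichlet_h2 \<Rightarrow> dirichlet_h2" where
  "trunc N f = Abs_dirichlet_h2 (\<lambda>n. if n \<le> N then dcoeff f n else 0)"

lemma dcoeff_trunc: "dcoeff (trunc N f) n = (if n \<le> N then dcoeff f n else 0)"
proof -
  have "summable (\<lambda>n. (cmod (if n \<le> N then dcoeff f n else 0))\<^sup>2)"
    by (rule summable_comparison_test'[OF summable_dcoeff[of f], of 0]) auto
  then show ?thesis unfolding trunc_def by (subst dcoeff_Abs) auto
qed

lemma finite_support_norm:
  assumes "\<forall>n>N. dcoeff f n = 0"
  shows "(norm f)\<^sup>2 = (\<Sum>n=1..N. (cmod (dcoeff f n))\<^sup>2)"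
proof -
  have "(norm f)\<^sup>2 = (\<Sum>n\<in>{1..N}. (cmod (dcoeff f n))\<^sup>2)"
    unfolding norm_dirichlet_h2_sq
  proof (rule suminf_finite)
    fix n assume "n \<notin> {1..N}"
    then have "n = 0 \<or> n > N" by auto
    then show "(cmod (dcoeff f n))\<^sup>2 = 0" using assms by auto
  qed auto
  then show ?thesis .
qed

lemma finite_support_eval:
  assumes "\<forall>n>N. dcoeff f n = 0" "s \<in> half_plane (1/2)"
  shows "dirichlet_eval f s = dpoly (dcoeff f) N s"
proof -
  have "dirichlet_eval f s = (\<Sum>n\<in>{1..N}. dcoeff f n * of_nat n powr (- s))"
    unfolding dirichlet_eval_def
  proof (rule suminf_finite)
    fix n assume "n \<notin> {1..N}"
    then have "n = 0 \<or> n > N" by auto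
    then show "dcoeff f n * of_nat n powr (- s) = 0" using assms by auto
  qed auto
  then show ?thesis by (simp add: dpoly_def)
qed

lemma norm_diff_trunc_sq:
  "(norm (f - trunc N f))\<^sup>2 = (norm f)\<^sup>2 - (\<Sum>n<Suc N. (cmod (dcoeff f n))\<^sup>2)"
proof -
  have "(norm (f - trunc N f))\<^sup>2 = (\<Sum>n. (cmod (dcoeff f n))\<^sup>2 - (cmod (dcoeff (trunc N f) n))\<^sup>2)"
    unfolding norm_dirichlet_h2_sq by (intro suminf_cong) (simp add: dcoeff_diff dcoeff_trunc)
  also have "\<dots> = (norm f)\<^sup>2 - (\<Sum>n. (cmod (dcoeff (trunc N f) n))\<^sup>2)"
    unfolding norm_dirichlet_h2_sq by (rule suminf_diff[symmetric]) (rule summable_dcoeff)+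
  also have "(\<Sum>n. (cmod (dcoeff (trunc N f) n))\<^sup>2) = (\<Sum>n<Suc N. (cmod (dcoeff (trunc N f) n))\<^sup>2)"
    by (rule suminf_finite) (auto simp: dcoeff_trunc)
  also have "\<dots> = (\<Sum>n<Suc N. (cmod (dcoeff f n))\<^sup>2)"
    by (intro sum.cong) (auto simp: dcoeff_trunc)
  finally show ?thesis .
qed

lemma norm_diff_trunc_le: "norm (f - trunc N f) \<le> norm f"
proof (rule power2_le_imp_le)
  have "(\<Sum>n<Suc N. (cmod (dcoeff f n))\<^sup>2) \<ge> 0" by (rule sum_nonneg) simp
  then show "(norm (f - trunc N f))\<^sup>2 \<le> (norm f)\<^sup>2" unfolding norm_diff_trunc_sq by linarith
qed simp

lemma trunc_tendsto: "(\<lambda>N. trunc N f) \<longlonglongrightarrow> f"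
proof -
  have "(\<lambda>N. \<Sum>n<Suc N. (cmod (dcoeff f n))\<^sup>2) \<longlonglongrightarrow> (norm f)\<^sup>2"
    unfolding norm_dirichlet_h2_sq by (intro LIMSEQ_Suc summable_LIMSEQ summable_dcoeff)
  then have "(\<lambda>N. (norm (f - trunc N f))\<^sup>2) \<longlonglongrightarrow> (norm f)\<^sup>2 - (norm f)\<^sup>2"
    unfolding norm_diff_trunc_sq by (intro tendsto_intros)
  then have "(\<lambda>N. sqrt ((norm (f - trunc N f))\<^sup>2)) \<longlonglongrightarrow> sqrt 0"
    by (intro tendsto_real_sqrt) simp
  then have "(\<lambda>N. norm (trunc N f - f)) \<longlonglongrightarrow> 0"
    by (simp add: norm_minus_commute)
  then show ?thesis using LIM_zero_cancel tendsto_norm_zero_iff by blast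
qed

text \<open>
  On the line \<open>Re s = 2\<close> the truncations of \<open>f\<close> tend to \<open>0\<close> uniformly, and the coefficients of a Dirichlet
  polynomial are bounded by its supremum on a line.
\<close>

lemma dirichlet_eval_eq_0_imp:
  assumes "\<And>s. s \<in> half_plane (1/2) \<Longrightarrow> dirichlet_eval f s = 0"
  shows "f = 0"
proof (rule dirichlet_h2_eqI)
  fix n
  define Z where "Z = sqrt (\<Sum>n. real n powr (- 2 * 2))"
  have le: "(cmod (dcoeff f n))\<^sup>2 * real n powr (- 2 * 2) \<le> (norm (trunc K f - f) * Z)\<^sup>2"
    if K: "K \<ge> n" and n: "n \<ge> 1" for K
  proof -
    have "(cmod (dcoeff f n))\<^sup>2 * real n powr (- 2 * 2) \<le> (\<Sum>n=1..K. (cmod (dcoeff f n))\<^sup>2 * real n powr (- 2 * 2))"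
      by (rule member_le_sum) (use K n in auto)
    also have "\<dots> \<le> (norm (trunc K f - f) * Z)\<^sup>2"
    proof (rule dpoly_coeff_bound)
      fix s assume s: "Re s = 2"
      then have s': "s \<in> half_plane (1/2)" by (simp add: half_plane_def)
      have "dpoly (dcoeff f) K s = dpoly (dcoeff (trunc K f)) K s"
        by (simp add: dpoly_def dcoeff_trunc)
      also have "\<dots> = dirichlet_eval (trunc K f) s"
        by (rule finite_support_eval[symmetric]) (auto simp: dcoeff_trunc s')
      also have "\<dots> = dirichlet_eval (trunc K f - f) s"
        by (simp add: dirichlet_eval_diff[OF s'] assms[OF s'])
      finally show "cmod (dpoly (dcoeff f) K s) \<le> norm (trunc K f - f) * Z"
        using dirichlet_eval_bound[OF s', of "trunc K f - f"] s by (simp add: Z_def)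
    qed simp
    finally show ?thesis .
  qed
  show "dcoeff f n = dcoeff 0 n"
  proof (cases "n \<ge> 1")
    case True
    have "(\<lambda>K. (norm (trunc K f - f) * Z)\<^sup>2) \<longlonglongrightarrow> (norm (f - f) * Z)\<^sup>2"
      by (intro tendsto_intros trunc_tendsto)
    then have "(cmod (dcoeff f n))\<^sup>2 * real n powr (- 2 * 2) \<le> (norm (f - f) * Z)\<^sup>2"
      by (rule LIMSEQ_le_const) (use le True in blast)
    then have "(cmod (dcoeff f n))\<^sup>2 * real n powr (- 2 * 2) = 0"
      by (intro antisym) auto
    then show ?thesis using True by (simp add: dcoeff_zero)
  qed (simp add: dcoeff_zero not_le)
qed

lemma dirichlet_eval_inject:
  assumes "\<And>s. s \<in> half_plane (1/2) \<Longrightarrow> dirichlet_eval f s = dirichlet_eval g s"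
  shows "f = g"
  using dirichlet_eval_eq_0_imp[of "f - g"] assms by (simp add: dirichlet_eval_diff)

text \<open>
  Approximating Dirichlet polynomials have coefficients that converge in every weighted space
  \<open>\<Sum> |b\<^sub>n|\<^sup>2 n\<^sup>-\<^sup>2\<^sup>\<sigma>\<close>, because the squared norm there is the mean of the squared modulus over a
  vertical line, where the polynomials are uniformly close.
  The limit coefficients inherit the bound \<open>M\<close> for each \<open>\<sigma> > 0\<close>, and \<open>\<sigma> \<rightarrow> 0\<close> gives the norm in \<open>\<H>\<close>.
\<close>

lemma dirichlet_h2_of_majorized:
  assumes F: "unif_dirichlet F"
    and U: "\<And>s. s \<in> half_plane 0 \<Longrightarrow> (cmod (F s))\<^sup>2 \<le> U s"
    and M: "\<And>\<sigma>. \<sigma> > 0 \<Longrightarrow> vmean \<sigma> U \<longlonglongrightarrow> M"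
  shows "\<exists>g. (\<forall>s\<in>half_plane (1/2). dirichlet_eval g s = F s) \<and> (norm g)\<^sup>2 \<le> M"
proof -
  define \<delta> where "\<delta> j = 1 / real (Suc j)" for j
  have \<delta>: "\<delta> j > 0" for j by (simp add: \<delta>_def)
  have \<delta>0: "\<delta> \<longlonglongrightarrow> 0" unfolding \<delta>_def by (rule LIMSEQ_Suc[OF lim_1_over_n])
  have small: "\<forall>\<^sub>F j in sequentially. \<delta> j < x" if "x > 0" for x
    using order_tendstoD(2)[OF \<delta>0 that] .
  have "\<exists>p. \<forall>s\<in>half_plane (\<delta> j). cmod (F s - dpoly (fst p) (snd p) s) \<le> \<delta> j" for j
    using unif_dirichletD[OF F \<delta> \<delta>, of j j] by auto
  then obtain p where p: "\<And>j. \<forall>s\<in>half_plane (\<delta> j). cmod (F s - dpoly (fst (p j)) (snd (p j)) s) \<le> \<delta> j"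
    by metis
  define b where "b j n = (if 1 \<le> n \<and> n \<le> snd (p j) then fst (p j) n else 0)" for j n
  have b: "cmod (F s - dpoly (b j) K s) \<le> \<delta> j" if "s \<in> half_plane (\<delta> j)" "K \<ge> snd (p j)" for s j K
  proof -
    have "dpoly (b j) K s = dpoly (fst (p j)) (snd (p j)) s"
      unfolding dpoly_def by (rule sum.mono_neutral_cong_right) (use that in \<open>auto simp: b_def\<close>)
    then show ?thesis using p that by simp
  qed
  have close: "(\<Sum>n=1..K. (cmod (b i n - b j n))\<^sup>2 * real n powr (- 2 * \<sigma>)) \<le> (\<delta> i + \<delta> j)\<^sup>2"
    if "\<delta> i < \<sigma>" "\<delta> j < \<sigma>" for i j \<sigma> K
  proof -
    define L where "L = max K (max (snd (p i)) (snd (p j)))"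
    have "(\<Sum>n=1..K. (cmod (b i n - b j n))\<^sup>2 * real n powr (- 2 * \<sigma>)) \<le>
        (\<Sum>n=1..L. (cmod (b i n - b j n))\<^sup>2 * real n powr (- 2 * \<sigma>))"
      by (rule sum_mono2) (auto simp: L_def)
    also have "\<dots> \<le> (\<delta> i + \<delta> j)\<^sup>2"
    proof (rule dpoly_coeff_bound)
      show "\<sigma> > 0" using \<delta>[of i] that by linarith
      fix s assume s: "Re s = \<sigma>"
      have "dpoly (\<lambda>n. b i n - b j n) L s = (F s - dpoly (b j) L s) - (F s - dpoly (b i) L s)"
        by (simp add: dpoly_diff_coeff)
      also have "cmod \<dots> \<le> \<delta> j + \<delta> i"
        using b[of s j L] b[of s i L] s that
        by (intro order.trans[OF norm_triangle_ineq4 add_mono]) (auto simp: half_plane_def L_def)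
      finally show "cmod (dpoly (\<lambda>n. b i n - b j n) L s) \<le> \<delta> i + \<delta> j" by simp
    qed
    finally show ?thesis .
  qed
  have "\<exists>l. (\<lambda>j. b j n) \<longlonglongrightarrow> l" for n
  proof (cases "n \<ge> 1")
    case True
    have "cmod (b i n - b j n) \<le> real n powr 2 * (\<delta> i + \<delta> j)" for i j
    proof -
      have lt: "\<delta> i < 2" "\<delta> j < 2" by (auto simp: \<delta>_def field_simps)
      have "(cmod (b i n - b j n))\<^sup>2 * real n powr (- 2 * 2) \<le> (\<Sum>n=1..n. (cmod (b i n - b j n))\<^sup>2 * real n powr (- 2 * 2))"
        by (rule member_le_sum) (use True in auto)
      also have "\<dots> \<le> (\<delta> i + \<delta> j)\<^sup>2" by (rule close[OF lt])
      also have "(cmod (b i n - b j n))\<^sup>2 * real n powr (- 2 * 2) = (cmod (b i n - b j n) * real n powr (- 2))\<^sup>2"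
        using powr_add[of "real n" "- 2" "- 2"] by (simp add: power2_eq_square)
      finally have "(cmod (b i n - b j n) * real n powr (- 2))\<^sup>2 \<le> (\<delta> i + \<delta> j)\<^sup>2" .
      then have "cmod (b i n - b j n) * real n powr (- 2) \<le> \<delta> i + \<delta> j"
        by (rule power2_le_imp_le) (use \<delta>[of i] \<delta>[of j] in simp)
      then show ?thesis using True by (simp add: powr_minus field_simps)
    qed
    note le = this
    have "Cauchy (\<lambda>j. b j n)"
    proof (rule metric_CauchyI)
      fix e :: real assume e: "e > 0"
      define r where "r = e / (2 * real n powr 2)"
      have r: "r > 0" using e True by (simp add: r_def)
      obtain J where J: "\<And>j. j \<ge> J \<Longrightarrow> \<delta> j < r"
        using small[OF r] by (auto simp: eventually_sequentially)
      have "dist (b i n) (b j n) < e" if "i \<ge> J" "j \<ge> J" for i j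
      proof -
        have "real n powr 2 * (\<delta> i + \<delta> j) < real n powr 2 * (r + r)"
          using J[OF that(1)] J[OF that(2)] True by (intro mult_strict_left_mono) auto
        also have "\<dots> = e" using True by (simp add: r_def)
        finally show ?thesis using le[of i j] by (simp add: dist_norm)
      qed
      then show "\<exists>J. \<forall>i\<ge>J. \<forall>j\<ge>J. dist (b i n) (b j n) < e" by blast
    qed
    then show ?thesis using Cauchy_convergent convergent_def by blast
  qed (auto simp: b_def intro!: exI[of _ 0])
  then obtain c where c: "\<And>n. (\<lambda>j. b j n) \<longlonglongrightarrow> c n" by metis
  have c0: "c 0 = 0" using c[of 0] by (simp add: b_def LIMSEQ_const_iff)
  have c_close: "(\<Sum>n=1..K. (cmod (c n - b j n))\<^sup>2 * real n powr (- 2 * \<sigma>)) \<le> (\<delta> j)\<^sup>2"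
    if j: "\<delta> j < \<sigma>" for j \<sigma> K
  proof (rule tendsto_le)
    show "(\<lambda>i. (\<delta> i + \<delta> j)\<^sup>2) \<longlonglongrightarrow> (\<delta> j)\<^sup>2"
      using tendsto_power[OF tendsto_add[OF \<delta>0 tendsto_const[of "\<delta> j"]], of 2] by simp
    show "(\<lambda>i. \<Sum>n=1..K. (cmod (b i n - b j n))\<^sup>2 * real n powr (- 2 * \<sigma>)) \<longlonglongrightarrow>
        (\<Sum>n=1..K. (cmod (c n - b j n))\<^sup>2 * real n powr (- 2 * \<sigma>))"
      by (intro tendsto_intros c)
    have "\<sigma> > 0" using \<delta>[of j] j by linarith
    show "\<forall>\<^sub>F i in sequentially. (\<Sum>n=1..K. (cmod (b i n - b j n))\<^sup>2 * real n powr (- 2 * \<sigma>)) \<le> (\<delta> i + \<delta> j)\<^sup>2"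
      using small[OF \<open>\<sigma> > 0\<close>] by eventually_elim (rule close[OF _ j])
  qed simp
  have wsum: "(\<Sum>n=1..K. (cmod (c n))\<^sup>2 * real n powr (- 2 * \<sigma>)) \<le> M" if \<sigma>: "\<sigma> > 0" for \<sigma> K
  proof -
    obtain B where B: "B > 0" "\<forall>s\<in>half_plane (\<sigma>/2). cmod (F s) \<le> B"
      using unif_dirichlet_bounded[OF F, of "\<sigma>/2"] \<sigma> by auto
    have bj: "(\<Sum>n=1..K. (cmod (b j n))\<^sup>2 * real n powr (- 2 * \<sigma>)) \<le> M + (2 * B * \<delta> j + (\<delta> j)\<^sup>2)"
      if j: "\<delta> j < \<sigma>" for j
    proof -
      define L where "L = max K (snd (p j))"
      have "(\<Sum>n=1..K. (cmod (b j n))\<^sup>2 * real n powr (- 2 * \<sigma>)) \<le> (\<Sum>n=1..L. (cmod (b j n))\<^sup>2 * real n powr (- 2 * \<sigma>))"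
        by (rule sum_mono2) (auto simp: L_def)
      also have "\<dots> \<le> M + (2 * B * \<delta> j + (\<delta> j)\<^sup>2)"
      proof (rule vmean_LIMSEQ_mono)
        show "vmean \<sigma> (\<lambda>s. (cmod (dpoly (b j) L s))\<^sup>2) \<longlonglongrightarrow> (\<Sum>n=1..L. (cmod (b j n))\<^sup>2 * real n powr (- 2 * \<sigma>))"
          by (rule vmean_dpoly_sq[OF \<sigma>])
        show "vmean \<sigma> (\<lambda>s. U s + (2 * B * \<delta> j + (\<delta> j)\<^sup>2)) \<longlonglongrightarrow> M + (2 * B * \<delta> j + (\<delta> j)\<^sup>2)"
        proof -
          have "vmean \<sigma> (\<lambda>s. U s + x) = (\<lambda>K. vmean \<sigma> U K + vmean \<sigma> (\<lambda>s. x) K)" for x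
            by (rule ext) (rule vmean_add)
          then show ?thesis using tendsto_add[OF M[OF \<sigma>] vmean_const] by (simp only:)
        qed
        fix s assume s: "Re s = \<sigma>"
        have hp: "s \<in> half_plane 0" "s \<in> half_plane (\<sigma>/2)" "s \<in> half_plane (\<delta> j)"
          using s \<sigma> j by (auto simp: half_plane_def)
        have "cmod (dpoly (b j) L s) \<le> cmod (F s) + \<delta> j"
          using b[OF hp(3), of L] norm_triangle_ineq3[of "F s" "dpoly (b j) L s"] by (simp add: L_def)
        then have "(cmod (dpoly (b j) L s))\<^sup>2 \<le> (cmod (F s) + \<delta> j)\<^sup>2" by (intro power_mono) auto
        also have "\<dots> = (cmod (F s))\<^sup>2 + (2 * cmod (F s) * \<delta> j + (\<delta> j)\<^sup>2)" by (simp add: power2_sum)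
        also have "\<dots> \<le> U s + (2 * B * \<delta> j + (\<delta> j)\<^sup>2)"
          using U[OF hp(1)] B(2)[rule_format, OF hp(2)] \<delta>[of j]
          by (intro add_mono mult_right_mono) auto
        finally show "(cmod (dpoly (b j) L s))\<^sup>2 \<le> U s + (2 * B * \<delta> j + (\<delta> j)\<^sup>2)" .
      qed
      finally show ?thesis .
    qed
    show ?thesis
    proof (rule tendsto_le)
      show "(\<lambda>j. M + (2 * B * \<delta> j + (\<delta> j)\<^sup>2)) \<longlonglongrightarrow> M"
        using tendsto_add[OF tendsto_const[of M] tendsto_add[OF tendsto_mult_left[OF \<delta>0, of "2 * B"] tendsto_power[OF \<delta>0, of 2]]]
        by simp
      show "(\<lambda>j. \<Sum>n=1..K. (cmod (b j n))\<^sup>2 * real n powr (- 2 * \<sigma>)) \<longlonglongrightarrow>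
          (\<Sum>n=1..K. (cmod (c n))\<^sup>2 * real n powr (- 2 * \<sigma>))"
        by (intro tendsto_intros c)
      show "\<forall>\<^sub>F j in sequentially. (\<Sum>n=1..K. (cmod (b j n))\<^sup>2 * real n powr (- 2 * \<sigma>)) \<le> M + (2 * B * \<delta> j + (\<delta> j)\<^sup>2)"
        using small[OF \<sigma>] by eventually_elim (rule bj)
    qed simp
  qed
  have csum: "(\<Sum>n<K. (cmod (c n))\<^sup>2) \<le> M" for K
  proof -
    have "(\<Sum>n<K. (cmod (c n))\<^sup>2) \<le> (\<Sum>n=1..K. (cmod (c n))\<^sup>2)"
    proof -
      have "(\<Sum>n<K. (cmod (c n))\<^sup>2) = (\<Sum>n\<in>{..<K}-{0}. (cmod (c n))\<^sup>2)"
        by (rule sum.mono_neutral_right) (auto simp: c0)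
      also have "\<dots> \<le> (\<Sum>n=1..K. (cmod (c n))\<^sup>2)"
        by (rule sum_mono2) auto
      finally show ?thesis .
    qed
    also have "\<dots> \<le> M"
    proof (rule LIMSEQ_le_const2)
      have "(\<lambda>j. \<Sum>n=1..K. (cmod (c n))\<^sup>2 * real n powr (- 2 * \<delta> j)) \<longlonglongrightarrow> (\<Sum>n=1..K. (cmod (c n))\<^sup>2 * real n powr (- 2 * 0))"
        by (intro tendsto_intros \<delta>0) auto
      also have "(\<Sum>n=1..K. (cmod (c n))\<^sup>2 * real n powr (- 2 * 0)) = (\<Sum>n=1..K. (cmod (c n))\<^sup>2)"
        by (intro sum.cong) auto
      finally show "(\<lambda>j. \<Sum>n=1..K. (cmod (c n))\<^sup>2 * real n powr (- 2 * \<delta> j)) \<longlonglongrightarrow> (\<Sum>n=1..K. (cmod (c n))\<^sup>2)" .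
    qed (use wsum[OF \<delta>] in blast)
    finally show ?thesis .
  qed
  have sm: "summable (\<lambda>n. (cmod (c n))\<^sup>2)"
    by (rule summableI_nonneg_bounded[where x = M]) (use csum in auto)
  define g where "g = Abs_dirichlet_h2 c"
  have g: "dcoeff g = c" unfolding g_def by (rule dcoeff_Abs[OF c0 sm])
  show ?thesis
  proof (intro exI conjI ballI)
    show "(norm g)\<^sup>2 \<le> M"
      unfolding norm_dirichlet_h2_sq g by (rule suminf_le_const[OF sm]) (rule csum)
    fix s assume s: "s \<in> half_plane (1/2)"
    \<comment> \<open>half of the room above \<open>1/2\<close> pays for the weight \<open>n\<^sup>-\<^sup>2\<^sup>\<sigma>\<close>, the other half for summability\<close>
    define \<sigma> where "\<sigma> = (Re s - 1/2) / 2"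
    define Z where "Z = (\<Sum>n. real n powr (- 2 * (Re s - \<sigma>)))"
    have \<sigma>: "\<sigma> > 0" "- 2 * (Re s - \<sigma>) < -1" "\<sigma> < Re s"
      using s by (auto simp: \<sigma>_def half_plane_def field_simps)
    have Z: "Z \<ge> 0" unfolding Z_def
      by (rule suminf_nonneg) (use \<sigma> summable_real_powr_iff in auto)
    have near: "cmod (F s - dpoly c K s) \<le> \<delta> j * (1 + sqrt Z)" if "\<delta> j < \<sigma>" "K \<ge> snd (p j)" for j K
    proof -
      have "(cmod (dpoly (\<lambda>n. c n - b j n) K s))\<^sup>2 \<le> (\<delta> j)\<^sup>2 * Z"
        by (rule order.trans[OF dpoly_Cauchy_Schwarz[of _ _ _ \<sigma>]])
          (use c_close[OF that(1)] sum_powr_le_suminf[OF \<sigma>(2)] Z in \<open>auto intro!: mult_mono sum_nonneg simp: Z_def\<close>)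
      also have "\<dots> = (\<delta> j * sqrt Z)\<^sup>2" using Z by (simp add: power_mult_distrib)
      finally have "cmod (dpoly (\<lambda>n. c n - b j n) K s) \<le> \<delta> j * sqrt Z"
        by (rule power2_le_imp_le) (use \<delta>[of j] Z in simp)
      moreover have "cmod (F s - dpoly (b j) K s) \<le> \<delta> j"
        using that \<sigma> by (intro b) (auto simp: half_plane_def)
      moreover have "F s - dpoly c K s = (F s - dpoly (b j) K s) - dpoly (\<lambda>n. c n - b j n) K s"
        by (simp add: dpoly_diff_coeff)
      ultimately show ?thesis
        using norm_triangle_ineq4[of "F s - dpoly (b j) K s" "dpoly (\<lambda>n. c n - b j n) K s"]
        by (simp add: algebra_simps)
    qed
    have "(\<lambda>K. dpoly c K s) \<longlonglongrightarrow> F s"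
    proof (rule LIMSEQ_I)
      fix r :: real assume r: "r > 0"
      have "min \<sigma> (r / (1 + sqrt Z)) > 0" using \<sigma> r Z by (simp add: add_pos_nonneg)
      from eventually_happens[OF small[OF this]] obtain j where j: "\<delta> j < \<sigma>" "\<delta> j < r / (1 + sqrt Z)"
        by auto
      have "\<delta> j * (1 + sqrt Z) < r"
        using j(2) Z by (simp add: pos_less_divide_eq add_pos_nonneg)
      then show "\<exists>K0. \<forall>K\<ge>K0. norm (dpoly c K s - F s) < r"
        using near[OF j(1)] by (metis norm_minus_commute order_le_less_trans)
    qed
    then show "dirichlet_eval g s = F s"
      using dirichlet_eval_limit[OF s, of g] unfolding g by (metis LIMSEQ_unique)
  qed
qed

section \<open>Composition operators with positive characteristic\<close>

text \<open>
  What the estimates use of a symbol of positive characteristic; \<open>\<psi>\<close> is an argument because bounds on it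
  are used later.
\<close>

definition admissible :: "nat \<Rightarrow> (complex \<Rightarrow> complex) \<Rightarrow> (complex \<Rightarrow> complex) \<Rightarrow> bool" where
  "admissible c0 \<phi> \<psi> \<longleftrightarrow> c0 \<ge> 1 \<and> unif_dirichlet \<psi> \<and>
     (\<forall>s\<in>half_plane 0. \<phi> s = of_nat c0 * s + \<psi> s \<and> Re (\<phi> s) > 0) \<and>
     \<phi> ` half_plane (1/2) \<subseteq> half_plane (1/2)"

lemma unif_dirichlet_compose:
  assumes adm: "admissible c0 \<phi> \<psi>"
  shows "unif_dirichlet (\<lambda>s. dpoly a N (\<phi> s))"
proof (rule unif_dirichlet_cong)
  show "unif_dirichlet (\<lambda>s. \<Sum>n=1..N. (a n * of_nat (n ^ c0) powr (- s)) * exp ((- of_real (ln (real n))) * \<psi> s))"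
    using adm
    by (intro unif_dirichlet_sum unif_dirichlet_mult unif_dirichlet_monomial unif_dirichlet_exp unif_dirichlet_const)
      (auto simp: admissible_def Suc_le_eq)
  fix s assume "s \<in> half_plane 0"
  then have \<phi>: "\<phi> s = of_nat c0 * s + \<psi> s" using adm by (simp add: admissible_def)
  show "(\<Sum>n=1..N. (a n * of_nat (n ^ c0) powr (- s)) * exp ((- of_real (ln (real n))) * \<psi> s)) = dpoly a N (\<phi> s)"
    unfolding dpoly_def
  proof (intro sum.cong refl)
    fix n assume n: "n \<in> {1..N}"
    then have "of_nat (n ^ c0) powr (- s) = exp (- (s * (of_nat c0 * complex_of_real (ln (real n)))))"
      by (subst nat_powr_exp) (auto simp: ln_realpow Suc_le_eq)
    moreover have "of_nat n powr (- \<phi> s) = exp (- (s * (of_nat c0 * complex_of_real (ln (real n)))) + (- of_real (ln (real n))) * \<psi> s)"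
      using n by (subst nat_powr_exp) (auto simp: \<phi> algebra_simps)
    ultimately show "(a n * of_nat (n ^ c0) powr (- s)) * exp ((- of_real (ln (real n))) * \<psi> s) = a n * of_nat n powr (- \<phi> s)"
      by (simp only: exp_add mult.assoc)
  qed
qed

lemma vmean_majorant_admissible:
  assumes "admissible c0 \<phi> \<psi>" "\<sigma> > 0"
  shows "vmean \<sigma> (\<lambda>s. majorant a N (\<phi> s)) \<longlonglongrightarrow> (\<Sum>n=1..N. (cmod (a n))\<^sup>2)"
  using assms by (intro vmean_majorant[of \<psi> \<phi> c0]) (auto simp: admissible_def)

lemma compose_finite:
  assumes adm: "admissible c0 \<phi> \<psi>" and fin: "\<forall>n>N. dcoeff f n = 0"
  shows "\<exists>g. (\<forall>s\<in>half_plane (1/2). dirichlet_eval g s = dirichlet_eval f (\<phi> s)) \<and> norm g \<le> norm f"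
proof -
  have "\<exists>g. (\<forall>s\<in>half_plane (1/2). dirichlet_eval g s = dpoly (dcoeff f) N (\<phi> s)) \<and>
      (norm g)\<^sup>2 \<le> (\<Sum>n=1..N. (cmod (dcoeff f n))\<^sup>2)"
  proof (rule dirichlet_h2_of_majorized)
    show "unif_dirichlet (\<lambda>s. dpoly (dcoeff f) N (\<phi> s))"
      by (rule unif_dirichlet_compose[OF adm])
    show "(cmod (dpoly (dcoeff f) N (\<phi> s)))\<^sup>2 \<le> majorant (dcoeff f) N (\<phi> s)" if "s \<in> half_plane 0" for s
      using adm that by (intro cmod_dpoly_le_majorant) (auto simp: admissible_def intro: less_imp_le)
    show "vmean \<sigma> (\<lambda>s. majorant (dcoeff f) N (\<phi> s)) \<longlonglongrightarrow> (\<Sum>n=1..N. (cmod (dcoeff f n))\<^sup>2)" if "\<sigma> > 0" for \<sigma>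
      by (rule vmean_majorant_admissible[OF adm that])
  qed
  then obtain g where g: "\<forall>s\<in>half_plane (1/2). dirichlet_eval g s = dpoly (dcoeff f) N (\<phi> s)"
    "(norm g)\<^sup>2 \<le> (\<Sum>n=1..N. (cmod (dcoeff f n))\<^sup>2)" by blast
  show ?thesis
  proof (intro exI conjI ballI)
    show "norm g \<le> norm f"
      by (rule power2_le_imp_le) (use g(2) finite_support_norm[OF fin] in simp_all)
    show "dirichlet_eval g s = dirichlet_eval f (\<phi> s)" if "s \<in> half_plane (1/2)" for s
    proof -
      have "\<phi> s \<in> half_plane (1/2)" using adm that by (auto simp: admissible_def)
      then show ?thesis using g(1) that by (simp add: finite_support_eval[OF fin])
    qed
  qed
qed

text \<open>
  The contraction estimate for finite series extends by density: compositions with the truncations of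
  \<open>f\<close> form a Cauchy sequence, and point evaluations on \<open>Re s > 1/2\<close> are continuous.
\<close>

lemma compose_exists:
  assumes adm: "admissible c0 \<phi> \<psi>"
  shows "\<exists>g. (\<forall>s\<in>half_plane (1/2). dirichlet_eval g s = dirichlet_eval f (\<phi> s)) \<and> norm g \<le> norm f"
proof -
  have \<phi>: "\<phi> s \<in> half_plane (1/2)" if "s \<in> half_plane (1/2)" for s
    using adm that by (auto simp: admissible_def)
  have fin: "\<forall>n>N. dcoeff (trunc N f) n = 0" for N
    by (simp add: dcoeff_trunc)
  have "\<exists>g. (\<forall>s\<in>half_plane (1/2). dirichlet_eval g s = dirichlet_eval (trunc N f) (\<phi> s)) \<and> norm g \<le> norm (trunc N f)" for N
    by (rule compose_finite[OF adm fin])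
  then have "\<exists>G. \<forall>N. (\<forall>s\<in>half_plane (1/2). dirichlet_eval (G N) s = dirichlet_eval (trunc N f) (\<phi> s)) \<and> norm (G N) \<le> norm (trunc N f)"
    by (intro choice allI)
  then obtain G where G: "\<And>N s. s \<in> half_plane (1/2) \<Longrightarrow> dirichlet_eval (G N) s = dirichlet_eval (trunc N f) (\<phi> s)"
    "\<And>N. norm (G N) \<le> norm (trunc N f)" by blast
  have dist: "dist (G N) (G M) \<le> dist (trunc N f) (trunc M f)" for N M
  proof -
    have "\<forall>n>max N M. dcoeff (trunc N f - trunc M f) n = 0"
      by (simp add: dcoeff_diff dcoeff_trunc)
    from compose_finite[OF adm this] obtain g where
      g: "\<And>s. s \<in> half_plane (1/2) \<Longrightarrow> dirichlet_eval g s = dirichlet_eval (trunc N f - trunc M f) (\<phi> s)"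
      "norm g \<le> norm (trunc N f - trunc M f)" by blast
    have "g = G N - G M"
      by (rule dirichlet_eval_inject) (simp add: g G dirichlet_eval_diff \<phi>)
    then show ?thesis using g(2) by (simp add: dist_norm)
  qed
  have "Cauchy G"
  proof (rule metric_CauchyI)
    fix e :: real assume "e > 0"
    then obtain K where "\<forall>m\<ge>K. \<forall>n\<ge>K. dist (trunc m f) (trunc n f) < e"
      using metric_CauchyD[OF LIMSEQ_imp_Cauchy[OF trunc_tendsto[of f]]] by blast
    then show "\<exists>K. \<forall>m\<ge>K. \<forall>n\<ge>K. dist (G m) (G n) < e"
      by (intro exI[of _ K] allI impI le_less_trans[OF dist]) simp
  qed
  then obtain g where g: "G \<longlonglongrightarrow> g" using Cauchy_convergent convergent_def by blast
  have ev: "(\<lambda>N. dirichlet_eval (h N) s) \<longlonglongrightarrow> dirichlet_eval l s"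
    if h: "h \<longlonglongrightarrow> l" and s: "s \<in> half_plane (1/2)" for h l s
  proof (rule LIM_zero_cancel, rule Lim_null_comparison)
    show "\<forall>\<^sub>F N in sequentially. norm (dirichlet_eval (h N) s - dirichlet_eval l s) \<le>
        norm (h N - l) * sqrt (\<Sum>n. real n powr (- 2 * Re s))"
      using dirichlet_eval_bound[OF s] by (intro always_eventually allI) (simp add: dirichlet_eval_diff[OF s, symmetric])
    show "(\<lambda>N. norm (h N - l) * sqrt (\<Sum>n. real n powr (- 2 * Re s))) \<longlonglongrightarrow> 0"
      by (intro tendsto_mult_left_zero tendsto_norm_zero LIM_zero h)
  qed
  have "dirichlet_eval g s = dirichlet_eval f (\<phi> s)" if s: "s \<in> half_plane (1/2)" for s
  proof (rule LIMSEQ_unique[OF ev[OF g s]])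
    show "(\<lambda>N. dirichlet_eval (G N) s) \<longlonglongrightarrow> dirichlet_eval f (\<phi> s)"
      unfolding G(1)[OF s] by (rule ev[OF trunc_tendsto \<phi>[OF s]])
  qed
  moreover have "norm g \<le> norm f"
    by (rule LIMSEQ_le[OF tendsto_norm[OF g] tendsto_norm[OF trunc_tendsto]]) (use G(2) in blast)
  ultimately show ?thesis by blast
qed

text \<open>
  The definitions of \<open>dirichlet_compose\<close> and \<open>comp_op\<close> by a definite description and by \<open>Blinfun\<close> are
  meaningful only once existence, uniqueness and boundedness are known.
\<close>

lemma comp_op_eval:
  assumes adm: "admissible c0 \<phi> \<psi>" and s: "s \<in> half_plane (1/2)"
  shows "dirichlet_eval (comp_op \<phi> f) s = dirichlet_eval f (\<phi> s)"
proof -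
  have \<phi>: "\<phi> s \<in> half_plane (1/2)" if "s \<in> half_plane (1/2)" for s
    using adm that by (auto simp: admissible_def)
  have comp: "(\<forall>s\<in>half_plane (1/2). dirichlet_eval (dirichlet_compose \<phi> f) s = dirichlet_eval f (\<phi> s)) \<and>
      norm (dirichlet_compose \<phi> f) \<le> norm f" for f
  proof -
    obtain g where g: "\<forall>s\<in>half_plane (1/2). dirichlet_eval g s = dirichlet_eval f (\<phi> s)" "norm g \<le> norm f"
      using compose_exists[OF adm] by blast
    have "dirichlet_compose \<phi> f = g"
      unfolding dirichlet_compose_def
    proof (rule the_equality)
      show "h = g" if "\<forall>s\<in>half_plane (1/2). dirichlet_eval h s = dirichlet_eval f (\<phi> s)" for h
        by (rule dirichlet_eval_inject) (simp add: that g(1))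
    qed (rule g(1))
    then show ?thesis using g by simp
  qed
  have "bounded_linear (dirichlet_compose \<phi>)"
  proof (rule bounded_linear_intro[where K = 1])
    show "dirichlet_compose \<phi> (x + y) = dirichlet_compose \<phi> x + dirichlet_compose \<phi> y" for x y
      by (rule dirichlet_eval_inject) (simp add: comp dirichlet_eval_add \<phi>)
    show "dirichlet_compose \<phi> (r *\<^sub>R x) = r *\<^sub>R dirichlet_compose \<phi> x" for r x
      by (rule dirichlet_eval_inject) (simp add: comp dirichlet_eval_scaleR \<phi>)
    show "norm (dirichlet_compose \<phi> x) \<le> norm x * 1" for x
      using comp by simp
  qed
  then show ?thesis using comp s by (simp add: comp_op_def bounded_linear_Blinfun_apply)
qed

text \<open>
  Operator estimates are reduced to pointwise ones: a bound on \<open>Re s > 0\<close> by a function with known vertical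
  means is a bound in \<open>\<H>\<close>.
\<close>

lemma comp_op_diff_majorized:
  assumes adm: "admissible c0 \<phi> \<psi>" "admissible c0' \<phi>' \<psi>'"
    and fin: "\<forall>n>N. dcoeff f n = 0"
    and U: "\<And>s. s \<in> half_plane 0 \<Longrightarrow>
      (cmod (dpoly (dcoeff f) N (\<phi> s) - dpoly (dcoeff f) N (\<phi>' s)))\<^sup>2 \<le> U s"
    and M: "\<And>\<sigma>. \<sigma> > 0 \<Longrightarrow> vmean \<sigma> U \<longlonglongrightarrow> M"
  shows "(norm ((comp_op \<phi> - comp_op \<phi>') f))\<^sup>2 \<le> M"
proof -
  have "unif_dirichlet (\<lambda>s. dpoly (dcoeff f) N (\<phi> s) + (- 1) * dpoly (dcoeff f) N (\<phi>' s))"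
    by (intro unif_dirichlet_add unif_dirichlet_mult unif_dirichlet_const unif_dirichlet_compose[OF adm(1)] unif_dirichlet_compose[OF adm(2)])
  then have "unif_dirichlet (\<lambda>s. dpoly (dcoeff f) N (\<phi> s) - dpoly (dcoeff f) N (\<phi>' s))" by simp
  then have "\<exists>g. (\<forall>s\<in>half_plane (1/2). dirichlet_eval g s = dpoly (dcoeff f) N (\<phi> s) - dpoly (dcoeff f) N (\<phi>' s)) \<and>
      (norm g)\<^sup>2 \<le> M"
    by (rule dirichlet_h2_of_majorized[where U = U]) (rule U M, assumption)+
  then obtain g where
    g: "\<forall>s\<in>half_plane (1/2). dirichlet_eval g s = dpoly (dcoeff f) N (\<phi> s) - dpoly (dcoeff f) N (\<phi>' s)"
    "(norm g)\<^sup>2 \<le> M" by blast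
  have "(comp_op \<phi> - comp_op \<phi>') f = g"
  proof (rule dirichlet_eval_inject)
    fix s assume s: "s \<in> half_plane (1/2)"
    then have "\<phi> s \<in> half_plane (1/2)" "\<phi>' s \<in> half_plane (1/2)"
      using adm by (auto simp: admissible_def)
    then show "dirichlet_eval ((comp_op \<phi> - comp_op \<phi>') f) s = dirichlet_eval g s"
      using g(1)[rule_format, OF s]
      by (simp add: finite_support_eval[OF fin] minus_blinfun.rep_eq dirichlet_eval_diff[OF s] comp_op_eval[OF adm(1) s] comp_op_eval[OF adm(2) s])
  qed
  then show ?thesis using g(2) by simp
qed

lemma blinfun_bound_by_trunc:
  fixes T :: "dirichlet_h2 \<Rightarrow>\<^sub>L dirichlet_h2"
  assumes "\<And>N. norm (T (trunc N f)) \<le> \<kappa> * norm (trunc N f)"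
  shows "norm (T f) \<le> \<kappa> * norm f"
proof (rule LIMSEQ_le)
  show "(\<lambda>N. norm (T (trunc N f))) \<longlonglongrightarrow> norm (T f)"
    by (intro tendsto_intros trunc_tendsto)
  show "(\<lambda>N. \<kappa> * norm (trunc N f)) \<longlonglongrightarrow> \<kappa> * norm f"
    by (intro tendsto_intros trunc_tendsto)
qed (use assms in blast)

text \<open>
  The hypothesis says that the factor in \<open>dpoly_diff_bound\<close> is at most \<open>\<kappa>\<^sup>2\<close>, so \<open>\<kappa>\<^sup>2 u\<^sub>f \<circ> \<phi>'\<close> majorizes.
\<close>

lemma comp_op_diff_Lipschitz:
  assumes adm: "admissible c0 \<phi> \<psi>" "admissible c0' \<phi>' \<psi>'" and \<kappa>: "\<kappa> \<ge> 0"
    and near: "\<And>s. s \<in> half_plane 0 \<Longrightarrow> (cmod (\<phi> s - \<phi>' s))\<^sup>2 \<le> 4 * \<kappa>\<^sup>2 * (Re (\<phi> s) * Re (\<phi>' s))"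
  shows "norm (comp_op \<phi> - comp_op \<phi>') \<le> \<kappa>"
proof (rule norm_blinfun_bound[OF \<kappa>], rule blinfun_bound_by_trunc)
  fix f N
  define a where "a = dcoeff (trunc N f)"
  have fin: "\<forall>n>N. dcoeff (trunc N f) n = 0"
    by (simp add: dcoeff_trunc)
  have "(norm ((comp_op \<phi> - comp_op \<phi>') (trunc N f)))\<^sup>2 \<le> \<kappa>\<^sup>2 * (\<Sum>n=1..N. (cmod (a n))\<^sup>2)"
  proof (rule comp_op_diff_majorized[OF adm fin])
    fix s assume s: "s \<in> half_plane 0"
    then have pos: "Re (\<phi> s) > 0" "Re (\<phi>' s) > 0" using adm by (auto simp: admissible_def)
    have "(cmod (dpoly a N (\<phi> s) - dpoly a N (\<phi>' s)))\<^sup>2 \<le>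
        (cmod (\<phi> s - \<phi>' s))\<^sup>2 / (4 * Re (\<phi>' s) * Re (\<phi> s)) * majorant a N (\<phi>' s)"
      by (rule dpoly_diff_bound[OF pos(2,1)])
    also have "\<dots> \<le> \<kappa>\<^sup>2 * majorant a N (\<phi>' s)"
    proof (rule mult_right_mono)
      show "(cmod (\<phi> s - \<phi>' s))\<^sup>2 / (4 * Re (\<phi>' s) * Re (\<phi> s)) \<le> \<kappa>\<^sup>2"
        using near[OF s] pos by (simp add: divide_le_eq mult_ac)
      show "majorant a N (\<phi>' s) \<ge> 0" using pos by (simp add: majorant_nonneg)
    qed
    finally show "(cmod (dpoly (dcoeff (trunc N f)) N (\<phi> s) - dpoly (dcoeff (trunc N f)) N (\<phi>' s)))\<^sup>2 \<le> \<kappa>\<^sup>2 * majorant a N (\<phi>' s)"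
      unfolding a_def .
  next
    show "vmean \<sigma> (\<lambda>s. \<kappa>\<^sup>2 * majorant a N (\<phi>' s)) \<longlonglongrightarrow> \<kappa>\<^sup>2 * (\<Sum>n=1..N. (cmod (a n))\<^sup>2)" if "\<sigma> > 0" for \<sigma>
      by (intro vmean_LIMSEQ_mult vmean_majorant_admissible[OF adm(2) that])
  qed
  also have "\<dots> = (\<kappa> * norm (trunc N f))\<^sup>2"
    using finite_support_norm[OF fin] by (simp add: a_def power_mult_distrib)
  finally show "norm ((comp_op \<phi> - comp_op \<phi>') (trunc N f)) \<le> \<kappa> * norm (trunc N f)"
    by (rule power2_le_imp_le) (use \<kappa> in simp)
qed

section \<open>A criterion for compactness\<close>

definition single :: "nat \<Rightarrow> complex \<Rightarrow> dirichlet_h2" where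
  "single n z = Abs_dirichlet_h2 (\<lambda>k. if k = n then z else 0)"

lemma dcoeff_single: "n \<ge> 1 \<Longrightarrow> dcoeff (single n z) k = (if k = n then z else 0)"
proof -
  assume n: "n \<ge> 1"
  have "summable (\<lambda>k. (cmod (if k = n then z else 0))\<^sup>2)"
    by (rule summable_finite[of "{n}"]) auto
  then show ?thesis unfolding single_def using n by (subst dcoeff_Abs) auto
qed

lemma bounded_linear_single: "n \<ge> 1 \<Longrightarrow> bounded_linear (single n)"
proof (rule bounded_linear_intro[where K = 1])
  assume n: "n \<ge> 1"
  show "single n (x + y) = single n x + single n y" for x y
    by (rule dirichlet_h2_eqI) (simp add: dcoeff_single[OF n] dcoeff_add)
  show "single n (r *\<^sub>R x) = r *\<^sub>R single n x" for r x
    by (rule dirichlet_h2_eqI) (simp add: dcoeff_single[OF n] dcoeff_scaleR)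
  show "norm (single n x) \<le> norm x * 1" for x
  proof -
    have "(norm (single n x))\<^sup>2 = (\<Sum>k=1..n. (cmod (dcoeff (single n x) k))\<^sup>2)"
      by (rule finite_support_norm) (simp add: dcoeff_single[OF n])
    also have "\<dots> = (\<Sum>k=1..n. if k = n then (cmod x)\<^sup>2 else 0)"
      by (intro sum.cong) (auto simp: dcoeff_single[OF n])
    also have "\<dots> = (cmod x)\<^sup>2" using n by simp
    finally show ?thesis by simp
  qed
qed

text \<open>
  The truncations of the unit ball lie in a finite sum of images of the unit disc of \<open>\<complex>\<close>.
\<close>

lemma trunc_compact: "\<exists>S. compact S \<and> (\<forall>f. norm f \<le> 1 \<longrightarrow> trunc N f \<in> S)"
proof (induction N)
  case 0
  have "trunc 0 f = 0" for f
    by (rule dirichlet_h2_eqI) (auto simp: dcoeff_trunc dcoeff_zero)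
  then show ?case by (intro exI[of _ "{0}"]) auto
next
  case (Suc N)
  then obtain S where S: "compact S" "\<forall>f. norm f \<le> 1 \<longrightarrow> trunc N f \<in> S" by blast
  let ?E = "single (Suc N) ` cball 0 1"
  have "compact ?E"
    by (intro compact_continuous_image linear_continuous_on bounded_linear_single compact_cball) simp
  then have "compact {x + y | x y. x \<in> S \<and> y \<in> ?E}" by (rule compact_sums[OF S(1)])
  moreover have "trunc (Suc N) f \<in> {x + y | x y. x \<in> S \<and> y \<in> ?E}" if f: "norm f \<le> 1" for f
  proof -
    have "dcoeff (single (Suc N) z) k = (if k = Suc N then z else 0)" for z k
      by (rule dcoeff_single) simp
    then have "trunc (Suc N) f = trunc N f + single (Suc N) (dcoeff f (Suc N))"
      by (intro dirichlet_h2_eqI) (auto simp: dcoeff_trunc dcoeff_add le_Suc_eq)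
    moreover have "dcoeff f (Suc N) \<in> cball 0 1"
      using cmod_dcoeff_le_norm[of f "Suc N"] f by simp
    ultimately show ?thesis using S(2) f by blast
  qed
  ultimately show ?case by blast
qed

text \<open>
  Such an operator is a norm limit of the finite-rank operators \<open>T \<circ> trunc N\<close>, so the image of the ball is
  totally bounded.
\<close>

lemma compact_operatorI:
  fixes T :: "dirichlet_h2 \<Rightarrow>\<^sub>L dirichlet_h2"
  assumes tail: "\<And>e. e > 0 \<Longrightarrow> \<exists>N. \<forall>f. (\<forall>n\<le>N. dcoeff f n = 0) \<longrightarrow> norm (T f) \<le> e * norm f"
  shows "compact_operator T"
  unfolding compact_operator_def compact_eq_totally_bounded
proof (intro conjI allI impI)
  show "complete (closure (blinfun_apply T ` cball 0 1))"
    by (simp add: complete_eq_closed)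
  fix e :: real assume e: "e > 0"
  obtain N where N: "\<forall>f. (\<forall>n\<le>N. dcoeff f n = 0) \<longrightarrow> norm (T f) \<le> e / 4 * norm f"
    using tail[of "e / 4"] e by auto
  obtain S where S: "compact S" "\<forall>f. norm f \<le> 1 \<longrightarrow> trunc N f \<in> S"
    using trunc_compact by blast
  have "compact (blinfun_apply T ` S)"
    by (intro compact_continuous_image S continuous_intros)
  moreover have "e / 4 > 0" using e by simp
  ultimately obtain k where k: "finite k" "blinfun_apply T ` S \<subseteq> (\<Union>x\<in>k. ball x (e / 4))"
    unfolding compact_eq_totally_bounded by blast
  have "blinfun_apply T ` cball 0 1 \<subseteq> (\<Union>x\<in>k. cball x (e / 2))"
  proof (rule image_subsetI)
    fix f :: dirichlet_h2 assume "f \<in> cball 0 1"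
    then have f: "norm f \<le> 1" by simp
    then obtain x where x: "x \<in> k" "dist x (T (trunc N f)) < e / 4" using S(2) k(2) by force
    have "norm (T (f - trunc N f)) \<le> e / 4 * norm (f - trunc N f)"
      using N by (simp add: dcoeff_diff dcoeff_trunc)
    also have "\<dots> \<le> e / 4 * 1"
      using norm_diff_trunc_le[of f N] f e by (intro mult_left_mono) auto
    finally have "dist (T (trunc N f)) (T f) \<le> e / 4"
      by (simp add: dist_norm blinfun.diff_right norm_minus_commute)
    then have "dist x (T f) \<le> e / 2"
      using x(2) dist_triangle[of x "T f" "T (trunc N f)"] by simp
    then show "T f \<in> (\<Union>x\<in>k. cball x (e / 2))" using x(1) by auto
  qed
  then have "closure (blinfun_apply T ` cball 0 1) \<subseteq> (\<Union>x\<in>k. cball x (e / 2))"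
    by (rule closure_minimal) (intro closed_UN k(1) ballI closed_cball)
  also have "\<dots> \<subseteq> (\<Union>x\<in>k. ball x e)" using e by (intro UN_mono) auto
  finally show "\<exists>k. finite k \<and> closure (blinfun_apply T ` cball 0 1) \<subseteq> (\<Union>x\<in>k. ball x e)"
    using k(1) by blast
qed

section \<open>Smallness of the difference on series that start late\<close>

text \<open>
  Since \<open>f(w) = g(w - \<theta>/2)\<close> for \<open>g = f(\<cdot> + \<theta>/2)\<close>, the value \<open>f(w)\<close> is that of \<open>g\<close> at a point still well inside
  the half-plane.  The increment estimate for \<open>g\<close> then acts as a Harnack inequality and moves the bound
  from there to \<open>v\<close>.
\<close>

lemma dpoly_tail_bound:
  assumes \<theta>: "\<theta> > 0" and w: "Re w \<ge> \<theta>" and v: "Re v \<ge> 1" and D: "cmod (w - of_real (\<theta>/2) - v) \<le> D"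
  shows "(cmod (dpoly a N w))\<^sup>2 \<le> (2 + D\<^sup>2 / \<theta>) * majorant (\<lambda>n. a n * of_real (real n powr (- \<theta>/2))) N v"
proof -
  define b where "b n = a n * of_real (real n powr (- \<theta>/2))" for n
  define w' where "w' = w - of_real (\<theta>/2)"
  have w': "Re w' \<ge> \<theta> / 2" "Re w' > 0" using w \<theta> by (auto simp: w'_def)
  have shift: "dpoly a N w = dpoly b N w'"
    unfolding dpoly_def
  proof (intro sum.cong refl)
    fix n assume n: "n \<in> {1..N}"
    then have "complex_of_real (real n powr (- \<theta>/2)) = exp (- (of_real (\<theta>/2) * of_real (ln (real n))))"
      by (simp add: powr_def exp_of_real[symmetric])
    moreover have "of_nat n powr (- w) = exp (- (of_real (\<theta>/2) * of_real (ln (real n)))) * of_nat n powr (- w')"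
    proof -
      have "n \<ge> 1" using n by simp
      then show ?thesis unfolding nat_powr_exp[OF \<open>n \<ge> 1\<close>] w'_def by (simp add: exp_add[symmetric] algebra_simps)
    qed
    ultimately show "a n * of_nat n powr (- w) = b n * of_nat n powr (- w')"
      by (simp only: b_def mult.assoc)
  qed
  have "(cmod (dpoly b N w'))\<^sup>2 \<le> 2 * (cmod (dpoly b N w' - dpoly b N v))\<^sup>2 + 2 * (cmod (dpoly b N v))\<^sup>2"
  proof -
    have "(cmod (dpoly b N w'))\<^sup>2 \<le> (cmod (dpoly b N w' - dpoly b N v) + cmod (dpoly b N v))\<^sup>2"
      using norm_triangle_ineq[of "dpoly b N w' - dpoly b N v" "dpoly b N v"] by (intro power_mono) auto
    also have "\<dots> \<le> 2 * (cmod (dpoly b N w' - dpoly b N v))\<^sup>2 + 2 * (cmod (dpoly b N v))\<^sup>2"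
      using sum_squares_bound[of "cmod (dpoly b N w' - dpoly b N v)" "cmod (dpoly b N v)"] by (simp add: power2_sum)
    finally show ?thesis .
  qed
  also have "\<dots> \<le> 2 * (D\<^sup>2 / (2 * \<theta>) * majorant b N v) + 2 * majorant b N v"
  proof (intro add_mono mult_left_mono)
    have "(cmod (dpoly b N w' - dpoly b N v))\<^sup>2 \<le> (cmod (w' - v))\<^sup>2 / (4 * Re v * Re w') * majorant b N v"
      by (rule dpoly_diff_bound) (use v w' in auto)
    also have "\<dots> \<le> D\<^sup>2 / (2 * \<theta>) * majorant b N v"
    proof (intro mult_right_mono frac_le)
      show "(cmod (w' - v))\<^sup>2 \<le> D\<^sup>2" using D by (intro power_mono) (auto simp: w'_def)
      have "1 * (\<theta> / 2) \<le> Re v * Re w'" using v w' \<theta> by (intro mult_mono) auto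
      then show "2 * \<theta> \<le> 4 * Re v * Re w'" by simp
    qed (use v \<theta> in \<open>auto intro: majorant_nonneg\<close>)
    finally show "(cmod (dpoly b N w' - dpoly b N v))\<^sup>2 \<le> D\<^sup>2 / (2 * \<theta>) * majorant b N v" .
  qed (use v in \<open>auto intro: cmod_dpoly_le_majorant\<close>)
  also have "\<dots> = (2 + D\<^sup>2 / \<theta>) * majorant b N v" using \<theta> by (simp add: field_simps)
  finally show ?thesis unfolding shift b_def .
qed

lemma cmod_diff_sq_le: "(cmod (x - y))\<^sup>2 \<le> 2 * (cmod x)\<^sup>2 + 2 * (cmod y)\<^sup>2"
proof -
  have "(cmod (x - y))\<^sup>2 \<le> (cmod x + cmod y)\<^sup>2"
    by (intro power_mono norm_triangle_ineq4) auto
  also have "\<dots> \<le> 2 * (cmod x)\<^sup>2 + 2 * (cmod y)\<^sup>2"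
    using sum_squares_bound[of "cmod x" "cmod y"] by (simp add: power2_sum)
  finally show ?thesis .
qed

text \<open>
  The two regimes, near the boundary and away from it, are added into one majorant valid at every point,
  so that its mean can be computed without splitting the vertical line.
\<close>

lemma comp_op_diff_tail:
  assumes adm: "admissible c0 \<phi>0 \<psi>0" "admissible c0 \<phi>1 \<psi>1"
    and \<psi>: "\<And>s. s \<in> half_plane 0 \<Longrightarrow> cmod (\<psi>0 s) \<le> C" "\<And>s. s \<in> half_plane 0 \<Longrightarrow> cmod (\<psi>1 s) \<le> C"
    and e: "e > 0" and \<theta>: "\<theta> > 0"
    and near: "\<And>s. s \<in> half_plane 0 \<Longrightarrow> min (Re (\<phi>0 s)) (Re (\<phi>1 s)) < \<theta> \<Longrightarrow>
      cmod (\<phi>0 s - \<phi>1 s) \<le> e * min (Re (\<phi>0 s)) (Re (\<phi>1 s))"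
  shows "\<exists>N. \<forall>f. (\<forall>n\<le>N. dcoeff f n = 0) \<longrightarrow> norm ((comp_op \<phi>0 - comp_op \<phi>1) f) \<le> e * norm f"
proof -
  \<comment> \<open>a bound for the distance from \<open>\<phi>\<^sub>j(s) - \<theta>/2\<close> to \<open>c\<^sub>0 s + 1\<close>\<close>
  define D where "D = C + \<theta> / 2 + 1"
  define K where "K = 2 + D\<^sup>2 / \<theta>"
  have K: "K > 0" using \<theta> by (simp add: K_def add_pos_nonneg)
  have "(\<lambda>N. 4 * K * real N powr (- \<theta>)) \<longlonglongrightarrow> 4 * K * 0"
    by (intro tendsto_intros tendsto_neg_powr filterlim_real_sequentially) (use \<theta> in simp)
  then have "\<forall>\<^sub>F N in sequentially. 4 * K * real N powr (- \<theta>) < e\<^sup>2 / 4"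
    using e by (intro order_tendstoD) auto
  then have "\<forall>\<^sub>F N in sequentially. 4 * K * real N powr (- \<theta>) < e\<^sup>2 / 4 \<and> N \<ge> 1"
    using eventually_ge_at_top[of 1] by eventually_elim simp
  then obtain N where N: "4 * K * real N powr (- \<theta>) < e\<^sup>2 / 4" "N \<ge> 1"
    using eventually_happens by fastforce
  have "norm ((comp_op \<phi>0 - comp_op \<phi>1) f) \<le> e * norm f" if f: "\<forall>n\<le>N. dcoeff f n = 0" for f
  proof (rule blinfun_bound_by_trunc)
    fix M
    define a where "a = dcoeff (trunc M f)"
    define b where "b n = a n * of_real (real n powr (- \<theta>/2))" for n
    define U where "U s = e\<^sup>2 / 4 * majorant a M (\<phi>1 s) + 4 * K * majorant b M (of_nat c0 * s + 1)" for s
    have fin: "\<forall>n>M. dcoeff (trunc M f) n = 0"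
      by (simp add: dcoeff_trunc)
    have "(norm ((comp_op \<phi>0 - comp_op \<phi>1) (trunc M f)))\<^sup>2 \<le>
        e\<^sup>2 / 4 * (\<Sum>n=1..M. (cmod (a n))\<^sup>2) + 4 * K * (\<Sum>n=1..M. (cmod (b n))\<^sup>2)"
    proof (rule comp_op_diff_majorized[OF adm fin])
      fix \<sigma> :: real assume \<sigma>: "\<sigma> > 0"
      have "c0 \<ge> 1" using adm(1) by (simp add: admissible_def)
      then have "vmean \<sigma> (\<lambda>s. majorant b M (of_nat c0 * s + 1)) \<longlonglongrightarrow> (\<Sum>n=1..M. (cmod (b n))\<^sup>2)"
        using \<sigma> by (intro vmean_majorant[of "\<lambda>s. 1" _ c0] unif_dirichlet_const) auto
      then show "vmean \<sigma> U \<longlonglongrightarrow> e\<^sup>2 / 4 * (\<Sum>n=1..M. (cmod (a n))\<^sup>2) + 4 * K * (\<Sum>n=1..M. (cmod (b n))\<^sup>2)"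
        unfolding U_def
        by (intro vmean_LIMSEQ_add vmean_LIMSEQ_mult vmean_majorant_admissible[OF adm(2) \<sigma>])
    next
      fix s assume s: "s \<in> half_plane 0"
      then have pos: "Re (\<phi>0 s) > 0" "Re (\<phi>1 s) > 0" and form: "\<phi>0 s = of_nat c0 * s + \<psi>0 s" "\<phi>1 s = of_nat c0 * s + \<psi>1 s"
        using adm by (auto simp: admissible_def)
      have v: "Re (of_nat c0 * s + 1) \<ge> 1" using s by (simp add: half_plane_def)
      have mpos: "majorant a M (\<phi>1 s) \<ge> 0" "majorant b M (of_nat c0 * s + 1) \<ge> 0"
        using pos v by (auto intro!: majorant_nonneg simp del: complex_add plus_complex.sel)
      have "(cmod (dpoly a M (\<phi>0 s) - dpoly a M (\<phi>1 s)))\<^sup>2 \<le> U s"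
      proof (cases "min (Re (\<phi>0 s)) (Re (\<phi>1 s)) < \<theta>")
        case True
        have "(cmod (\<phi>0 s - \<phi>1 s))\<^sup>2 \<le> (e * min (Re (\<phi>0 s)) (Re (\<phi>1 s)))\<^sup>2"
          using near[OF s True] by (intro power_mono) auto
        also have "\<dots> \<le> e\<^sup>2 * (Re (\<phi>1 s) * Re (\<phi>0 s))"
          unfolding power_mult_distrib using pos
          by (intro mult_left_mono) (auto simp: power2_eq_square intro!: mult_mono)
        finally have "(cmod (\<phi>0 s - \<phi>1 s))\<^sup>2 / (4 * Re (\<phi>1 s) * Re (\<phi>0 s)) \<le> e\<^sup>2 / 4"
          using pos by (simp add: divide_simps mult_ac)
        then have "(cmod (\<phi>0 s - \<phi>1 s))\<^sup>2 / (4 * Re (\<phi>1 s) * Re (\<phi>0 s)) * majorant a M (\<phi>1 s) \<le> e\<^sup>2 / 4 * majorant a M (\<phi>1 s)"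
          by (rule mult_right_mono) (rule mpos)
        moreover have "4 * K * majorant b M (of_nat c0 * s + 1) \<ge> 0"
          using K mpos(2) by simp
        ultimately show ?thesis
          using dpoly_diff_bound[OF pos(2,1), of a M] unfolding U_def by linarith
      next
        case False
        have D: "cmod (z - of_real (\<theta>/2) - 1) \<le> D" if "cmod z \<le> C" for z
        proof -
          have "cmod (z - of_real (\<theta>/2) - 1) \<le> cmod z + cmod (complex_of_real (\<theta>/2)) + cmod 1"
            by (intro order.trans[OF norm_triangle_ineq4] add_mono norm_triangle_ineq4 order_refl)
          then show ?thesis using that \<theta> by (simp add: D_def)
        qed
        have "(cmod (dpoly a M (\<phi>0 s)))\<^sup>2 \<le> K * majorant b M (of_nat c0 * s + 1)"
          unfolding K_def b_def
          by (rule dpoly_tail_bound[OF \<theta> _ v]) (use False D[OF \<psi>(1)[OF s]] in \<open>auto simp: form algebra_simps\<close>)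
        moreover have "(cmod (dpoly a M (\<phi>1 s)))\<^sup>2 \<le> K * majorant b M (of_nat c0 * s + 1)"
          unfolding K_def b_def
          by (rule dpoly_tail_bound[OF \<theta> _ v]) (use False D[OF \<psi>(2)[OF s]] in \<open>auto simp: form algebra_simps\<close>)
        moreover have "e\<^sup>2 / 4 * majorant a M (\<phi>1 s) \<ge> 0" using mpos by simp
        ultimately show ?thesis
          using cmod_diff_sq_le[of "dpoly a M (\<phi>0 s)" "dpoly a M (\<phi>1 s)"] unfolding U_def by linarith
      qed
      then show "(cmod (dpoly (dcoeff (trunc M f)) M (\<phi>0 s) - dpoly (dcoeff (trunc M f)) M (\<phi>1 s)))\<^sup>2 \<le> U s"
        unfolding a_def .
    qed
    also have "\<dots> \<le> e\<^sup>2 / 4 * (\<Sum>n=1..M. (cmod (a n))\<^sup>2) + 4 * K * (real N powr (- \<theta>) * (\<Sum>n=1..M. (cmod (a n))\<^sup>2))"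
    proof -
      have "(\<Sum>n=1..M. (cmod (b n))\<^sup>2) \<le> real N powr (- \<theta>) * (\<Sum>n=1..M. (cmod (a n))\<^sup>2)"
        unfolding sum_distrib_left
      proof (rule sum_mono)
        fix n
        show "(cmod (b n))\<^sup>2 \<le> real N powr (- \<theta>) * (cmod (a n))\<^sup>2"
        proof (cases "n \<le> N")
          case True
          then show ?thesis using f by (simp add: b_def a_def dcoeff_trunc)
        next
          case False
          have "(cmod (b n))\<^sup>2 = real n powr (- \<theta>) * (cmod (a n))\<^sup>2"
            using powr_add[of "real n" "- \<theta>/2" "- \<theta>/2"] by (simp add: b_def norm_mult power_mult_distrib power2_eq_square)
          also have "\<dots> \<le> real N powr (- \<theta>) * (cmod (a n))\<^sup>2"
            using False N \<theta> by (intro mult_right_mono powr_mono2') auto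
          finally show ?thesis .
        qed
      qed
      then show ?thesis using K by (intro add_left_mono mult_left_mono) auto
    qed
    also have "\<dots> = (e\<^sup>2 / 4 + 4 * K * real N powr (- \<theta>)) * (norm (trunc M f))\<^sup>2"
      using finite_support_norm[OF fin] by (simp add: a_def algebra_simps)
    also have "\<dots> \<le> e\<^sup>2 * (norm (trunc M f))\<^sup>2"
    proof (rule mult_right_mono)
      show "e\<^sup>2 / 4 + 4 * K * real N powr (- \<theta>) \<le> e\<^sup>2"
        using N(1) zero_le_power2[of e] by linarith
    qed simp
    finally have "(norm ((comp_op \<phi>0 - comp_op \<phi>1) (trunc M f)))\<^sup>2 \<le> (e * norm (trunc M f))\<^sup>2"
      by (simp add: power_mult_distrib)
    then show "norm ((comp_op \<phi>0 - comp_op \<phi>1) (trunc M f)) \<le> e * norm (trunc M f)"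
      by (rule power2_le_imp_le) (use e in simp)
  qed
  then show ?thesis by blast
qed

section \<open>Symbols of the Gordon--Hedenmalm class\<close>

lemma gh_symbol_admissible:
  assumes "gh_symbol c0 \<phi>" "c0 \<ge> 1"
  shows "\<exists>\<psi>. admissible c0 \<phi> \<psi>"
proof -
  obtain c \<psi> where \<psi>: "\<phi> ` half_plane (1/2) \<subseteq> half_plane (1/2)"
      "\<forall>s\<in>half_plane 0. \<phi> s = of_nat c0 * s + \<psi> s"
      "\<forall>\<epsilon>>0. uniform_limit (half_plane \<epsilon>) (\<lambda>N s. \<Sum>n=1..N. c n * of_nat n powr (- s)) \<psi> sequentially"
      "((\<forall>s\<in>half_plane 0. \<psi> s = c 1) \<and> Re (c 1) \<ge> 0) \<or> \<psi> ` half_plane 0 \<subseteq> half_plane 0"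
    using assms unfolding gh_symbol_def by auto
  have pos: "Re (\<phi> s) > 0" if s: "s \<in> half_plane 0" for s
  proof -
    have "Re (\<psi> s) \<ge> 0" using \<psi>(4) s by (auto simp: half_plane_def less_imp_le)
    moreover have "Re (\<phi> s) = of_nat c0 * Re s + Re (\<psi> s)" using \<psi>(2) s by simp
    moreover have "real c0 * Re s > 0" using assms(2) s by (simp add: half_plane_def)
    ultimately show ?thesis by linarith
  qed
  have "unif_dirichlet \<psi>"
    unfolding unif_dirichlet_def
  proof (intro allI impI)
    fix e d :: real assume "e > 0" "d > 0"
    with \<psi>(3) have "\<forall>\<^sub>F N in sequentially. \<forall>s\<in>half_plane e. dist (\<Sum>n=1..N. c n * of_nat n powr (- s)) (\<psi> s) < d"
      by (intro uniform_limitD) auto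
    then obtain N where "\<forall>s\<in>half_plane e. dist (dpoly c N s) (\<psi> s) < d"
      unfolding dpoly_def by (auto simp: eventually_sequentially)
    then have "\<forall>s\<in>half_plane e. cmod (\<psi> s - dpoly c N s) \<le> d"
      by (simp add: dist_norm norm_minus_commute less_imp_le)
    then show "\<exists>a N. \<forall>s\<in>half_plane e. cmod (\<psi> s - dpoly a N s) \<le> d" by blast
  qed
  then show ?thesis using assms(2) \<psi> pos unfolding admissible_def by blast
qed

lemma gh_symbol_bounded_remainder:
  assumes "gh_symbol c0 \<phi>"
  shows "\<exists>B. \<forall>s\<in>half_plane 1. cmod (\<phi> s - of_nat c0 * s) \<le> B"
proof -
  obtain c \<psi> where \<psi>: "\<forall>s\<in>half_plane 0. \<phi> s = of_nat c0 * s + \<psi> s"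
      "\<forall>\<epsilon>>0. uniform_limit (half_plane \<epsilon>) (\<lambda>N s. \<Sum>n=1..N. c n * of_nat n powr (- s)) \<psi> sequentially"
    using assms unfolding gh_symbol_def by auto
  have "\<forall>\<^sub>F N in sequentially. \<forall>s\<in>half_plane 1. dist (\<Sum>n=1..N. c n * of_nat n powr (- s)) (\<psi> s) < 1"
    using \<psi>(2) by (intro uniform_limitD) auto
  then obtain N where N: "\<forall>s\<in>half_plane 1. dist (dpoly c N s) (\<psi> s) < 1"
    unfolding dpoly_def by (auto simp: eventually_sequentially)
  have "cmod (\<phi> s - of_nat c0 * s) \<le> 1 + (\<Sum>n=1..N. cmod (c n))" if s: "s \<in> half_plane 1" for s
  proof -
    have s0: "s \<in> half_plane 0" using s by (simp add: half_plane_def)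
    have "\<phi> s - of_nat c0 * s = (\<psi> s - dpoly c N s) + dpoly c N s" using \<psi>(1) s0 by simp
    also have "cmod \<dots> \<le> 1 + (\<Sum>n=1..N. cmod (c n))"
      by (rule norm_triangle_mono)
        (use N s dpoly_bounded[OF s0, of c N] in \<open>auto simp: dist_norm norm_minus_commute less_imp_le\<close>)
    finally show ?thesis .
  qed
  then show ?thesis by blast
qed

text \<open>
  Two representations with \<open>a \<noteq> b\<close> would make \<open>(a - b) s\<close> bounded on \<open>Re s > 1\<close>.
\<close>

lemma gh_symbol_char_unique:
  assumes "gh_symbol a \<phi>" "gh_symbol b \<phi>"
  shows "a = b"
proof (rule ccontr)
  assume "a \<noteq> b"
  obtain A where A: "\<forall>s\<in>half_plane 1. cmod (\<phi> s - of_nat a * s) \<le> A"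
    using gh_symbol_bounded_remainder[OF assms(1)] by blast
  obtain B where B: "\<forall>s\<in>half_plane 1. cmod (\<phi> s - of_nat b * s) \<le> B"
    using gh_symbol_bounded_remainder[OF assms(2)] by blast
  define x where "x = \<bar>A\<bar> + \<bar>B\<bar> + 2"
  have x: "complex_of_real x \<in> half_plane 1" "x > 0" by (auto simp: x_def half_plane_def)
  have "1 \<le> \<bar>int a - int b\<bar>" using \<open>a \<noteq> b\<close> by linarith
  then have "1 \<le> real_of_int \<bar>int a - int b\<bar>" by linarith
  then have "1 \<le> \<bar>real a - real b\<bar>" by simp
  then have "x \<le> \<bar>real a - real b\<bar> * x" using x(2) by simp
  also have "\<dots> = cmod (of_real ((real a - real b) * x))"
    using x(2) by (simp only: norm_of_real abs_mult abs_of_pos)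
  also have "of_real ((real a - real b) * x) = (\<phi> x - of_nat b * x) - (\<phi> x - of_nat a * x)"
    by (simp add: algebra_simps)
  also have "cmod \<dots> \<le> B + A"
    using A B x(1) by (intro order.trans[OF norm_triangle_ineq4 add_mono]) auto
  finally show False unfolding x_def by linarith
qed

lemma gh_symbol_gh_char:
  assumes "\<phi> \<in> GH_class"
  shows "gh_symbol (gh_char \<phi>) \<phi>"
proof -
  obtain c0 where c0: "gh_symbol c0 \<phi>" using assms by (auto simp: GH_class_def)
  then have "gh_char \<phi> = c0"
    unfolding gh_char_def by (rule the_equality) (rule gh_symbol_char_unique[OF _ c0])
  then show ?thesis using c0 by simp
qed

lemma half_plane_convex: "convex (half_plane r)"
proof -
  have "half_plane r = {s. inner 1 s > r}" by (auto simp: half_plane_def inner_complex_def)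
  then show ?thesis by (simp only: convex_halfspace_gt)
qed

text \<open>
  The class is convex for a fixed positive characteristic, although the condition on \<open>\<psi>\<close> is a disjunction: if one of
  the two functions is in the open half-plane, so is a proper convex combination with one whose real
  part is nonnegative.
\<close>

lemma gh_symbol_convex:
  assumes \<phi>0: "gh_symbol c0 \<phi>0" and \<phi>1: "gh_symbol c0 \<phi>1" and c0: "c0 \<ge> 1" and t: "t \<in> {0..1}"
  shows "gh_symbol c0 (\<lambda>s. (1 - t) *\<^sub>R \<phi>0 s + t *\<^sub>R \<phi>1 s)"
proof (cases "t = 0 \<or> t = 1")
  case True
  then show ?thesis using \<phi>0 \<phi>1 by auto
next
  case False
  then have t: "0 < t" "t < 1" using t by auto
  obtain c \<psi> where a: "\<phi>0 ` half_plane (1/2) \<subseteq> half_plane (1/2)"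
      "\<forall>s\<in>half_plane 0. \<phi>0 s = of_nat c0 * s + \<psi> s"
      "\<forall>\<epsilon>>0. uniform_limit (half_plane \<epsilon>) (\<lambda>N s. \<Sum>n=1..N. c n * of_nat n powr (- s)) \<psi> sequentially"
      "((\<forall>s\<in>half_plane 0. \<psi> s = c 1) \<and> Re (c 1) \<ge> 0) \<or> \<psi> ` half_plane 0 \<subseteq> half_plane 0"
    using \<phi>0 c0 unfolding gh_symbol_def by auto
  obtain d \<rho> where b: "\<phi>1 ` half_plane (1/2) \<subseteq> half_plane (1/2)"
      "\<forall>s\<in>half_plane 0. \<phi>1 s = of_nat c0 * s + \<rho> s"
      "\<forall>\<epsilon>>0. uniform_limit (half_plane \<epsilon>) (\<lambda>N s. \<Sum>n=1..N. d n * of_nat n powr (- s)) \<rho> sequentially"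
      "((\<forall>s\<in>half_plane 0. \<rho> s = d 1) \<and> Re (d 1) \<ge> 0) \<or> \<rho> ` half_plane 0 \<subseteq> half_plane 0"
    using \<phi>1 c0 unfolding gh_symbol_def by auto
  define e where "e n = (1 - t) *\<^sub>R c n + t *\<^sub>R d n" for n
  define \<omega> where "\<omega> s = (1 - t) *\<^sub>R \<psi> s + t *\<^sub>R \<rho> s" for s
  show ?thesis
    unfolding gh_symbol_def
  proof (intro conjI exI[of _ e] exI[of _ \<omega>] ballI allI impI)
    show "(\<lambda>s. (1 - t) *\<^sub>R \<phi>0 s + t *\<^sub>R \<phi>1 s) ` half_plane (1/2) \<subseteq> half_plane (1/2)"
      using a(1) b(1) t by (intro image_subsetI convexD[OF half_plane_convex]) auto
    show "(1 - t) *\<^sub>R \<phi>0 s + t *\<^sub>R \<phi>1 s = of_nat c0 * s + \<omega> s" if "s \<in> half_plane 0" for s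
      using a(2) b(2) that by (simp add: \<omega>_def algebra_simps)
    show "uniform_limit (half_plane r) (\<lambda>N s. \<Sum>n=1..N. e n * of_nat n powr (- s)) \<omega> sequentially" if r: "r > 0" for r
    proof -
      have "uniform_limit (half_plane r) (\<lambda>N s. (1 - t) *\<^sub>R (\<Sum>n=1..N. c n * of_nat n powr (- s)) + t *\<^sub>R (\<Sum>n=1..N. d n * of_nat n powr (- s)))
          (\<lambda>s. (1 - t) *\<^sub>R \<psi> s + t *\<^sub>R \<rho> s) sequentially"
        using a(3) b(3) r
        by (intro uniform_limit_add bounded_linear.uniform_limit[OF bounded_linear_scaleR_right]) auto
      also have "(\<lambda>N s. (1 - t) *\<^sub>R (\<Sum>n=1..N. c n * of_nat n powr (- s)) + t *\<^sub>R (\<Sum>n=1..N. d n * of_nat n powr (- s)))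
          = (\<lambda>N s. \<Sum>n=1..N. e n * of_nat n powr (- s))"
        by (simp add: e_def sum.distrib[symmetric] scaleR_sum_right distrib_right)
      finally show ?thesis by (simp add: \<omega>_def[abs_def])
    qed
    show "\<omega> ` half_plane 0 \<subseteq> half_plane (1/2)" if "c0 = 0" using that c0 by simp
    have nn: "Re (\<psi> s) \<ge> 0" "Re (\<rho> s) \<ge> 0" if "s \<in> half_plane 0" for s
      using a(4) b(4) that by (auto simp: half_plane_def less_imp_le)
    have Re\<omega>: "Re (\<omega> s) = (1 - t) * Re (\<psi> s) + t * Re (\<rho> s)" for s by (simp add: \<omega>_def)
    show "((\<forall>s\<in>half_plane 0. \<omega> s = e 1) \<and> 0 \<le> Re (e 1)) \<or> \<omega> ` half_plane 0 \<subseteq> half_plane 0"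
    proof (cases "\<psi> ` half_plane 0 \<subseteq> half_plane 0 \<or> \<rho> ` half_plane 0 \<subseteq> half_plane 0")
      case True
      have "Re (\<omega> s) > 0" if s: "s \<in> half_plane 0" for s
      proof -
        have "Re (\<psi> s) > 0 \<or> Re (\<rho> s) > 0" using True s by (auto simp: half_plane_def)
        then show ?thesis unfolding Re\<omega>
          using nn[OF s] t by (auto intro: add_pos_nonneg add_nonneg_pos)
      qed
      then show ?thesis by (auto simp: half_plane_def)
    next
      case False
      then show ?thesis using a(4) b(4) t by (auto simp: \<omega>_def e_def)
    qed
  qed
qed

section \<open>The component and the compact difference\<close>

theorem theorem5p5:
  fixes \<phi>0 \<phi>1 \<psi>0 \<psi>1 :: "complex \<Rightarrow> complex" and c0 :: nat and C :: real
  assumes "\<phi>0 \<in> GH_class" and "\<phi>1 \<in> GH_class"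
    and "gh_char \<phi>0 = c0" and "gh_char \<phi>1 = c0" and "c0 \<ge> 1"
    and "\<And>s. s \<in> half_plane 0 \<Longrightarrow> \<phi>0 s = of_nat c0 * s + \<psi>0 s"
    and "\<And>s. s \<in> half_plane 0 \<Longrightarrow> \<phi>1 s = of_nat c0 * s + \<psi>1 s"
    and "C > 0"
    and "\<And>s. s \<in> half_plane 0 \<Longrightarrow> cmod (\<phi>0 s - \<phi>1 s) \<le> C * min (Re (\<phi>0 s)) (Re (\<phi>1 s))"
    and "\<And>s. s \<in> half_plane 0 \<Longrightarrow> cmod (\<psi>0 s) \<le> C"
    and "\<And>s. s \<in> half_plane 0 \<Longrightarrow> cmod (\<psi>1 s) \<le> C"
    and "\<And>s. s \<in> half_plane 0 \<Longrightarrow> cmod (deriv \<phi>0 s - deriv \<phi>1 s) \<le> C"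
  shows "connected_component comp_ops (comp_op \<phi>0) (comp_op \<phi>1) \<and>
    ((\<forall>\<epsilon>>0. \<exists>\<theta>>0. \<forall>s\<in>half_plane 0. min (Re (\<phi>0 s)) (Re (\<phi>1 s)) < \<theta> \<longrightarrow>
         cmod (\<phi>0 s - \<phi>1 s) \<le> \<epsilon> * min (Re (\<phi>0 s)) (Re (\<phi>1 s)) \<and>
         cmod (deriv \<phi>0 s - deriv \<phi>1 s) \<le> \<epsilon>)
     \<longrightarrow> compact_operator (comp_op \<phi>0 - comp_op \<phi>1))"
proof (intro conjI impI)
  note C = \<open>C > 0\<close> and near = assms(9)
  have gh: "gh_symbol c0 \<phi>0" "gh_symbol c0 \<phi>1"
    using gh_symbol_gh_char[OF assms(1)] gh_symbol_gh_char[OF assms(2)] assms(3,4) by simp_all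
  define \<phi> where "\<phi> t s = (1 - t) *\<^sub>R \<phi>0 s + t *\<^sub>R \<phi>1 s" for t :: real and s
  have gh\<phi>: "gh_symbol c0 (\<phi> t)" if "t \<in> {0..1}" for t
    unfolding \<phi>_def by (rule gh_symbol_convex[OF gh \<open>c0 \<ge> 1\<close> that])
  have adm: "\<exists>\<psi>. admissible c0 (\<phi> t) \<psi>" if "t \<in> {0..1}" for t
    by (rule gh_symbol_admissible[OF gh\<phi>[OF that] \<open>c0 \<ge> 1\<close>])
  have ends: "\<phi> 0 = \<phi>0" "\<phi> 1 = \<phi>1" by (auto simp: \<phi>_def)
  have pos: "Re (\<phi>0 s) > 0" "Re (\<phi>1 s) > 0" if "s \<in> half_plane 0" for s
    using adm[of 0] adm[of 1] that by (auto simp: ends admissible_def)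
  have lip: "dist (comp_op (\<phi> t)) (comp_op (\<phi> u)) \<le> C / 2 * dist t u" if t: "t \<in> {0..1}" and u: "u \<in> {0..1}" for t u
  proof -
    obtain \<psi>t \<psi>u where ad: "admissible c0 (\<phi> t) \<psi>t" "admissible c0 (\<phi> u) \<psi>u"
      using adm[OF t] adm[OF u] by blast
    have "norm (comp_op (\<phi> t) - comp_op (\<phi> u)) \<le> C / 2 * \<bar>t - u\<bar>"
    proof (rule comp_op_diff_Lipschitz[OF ad])
      fix s assume s: "s \<in> half_plane 0"
      define m where "m = min (Re (\<phi>0 s)) (Re (\<phi>1 s))"
      have m: "m > 0" using pos[OF s] by (simp add: m_def)
      have ge: "Re (\<phi> r s) \<ge> m" if "r \<in> {0..1}" for r
      proof -
        have "m = (1 - r) * m + r * m" by (simp add: algebra_simps)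
        also have "\<dots> \<le> (1 - r) * Re (\<phi>0 s) + r * Re (\<phi>1 s)"
          using that by (intro add_mono mult_left_mono) (auto simp: m_def)
        finally show ?thesis by (simp add: \<phi>_def)
      qed
      have "\<phi> t s - \<phi> u s = (u - t) *\<^sub>R (\<phi>0 s - \<phi>1 s)"
        by (simp add: \<phi>_def algebra_simps)
      then have "cmod (\<phi> t s - \<phi> u s) \<le> \<bar>t - u\<bar> * (C * m)"
        using near[OF s] by (simp add: m_def abs_minus_commute mult_left_mono)
      then have "(cmod (\<phi> t s - \<phi> u s))\<^sup>2 \<le> (\<bar>t - u\<bar> * (C * m))\<^sup>2" by (intro power_mono) auto
      also have "\<dots> = 4 * (C / 2 * \<bar>t - u\<bar>)\<^sup>2 * (m * m)"
        by (simp add: power2_eq_square algebra_simps)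
      also have "\<dots> \<le> 4 * (C / 2 * \<bar>t - u\<bar>)\<^sup>2 * (Re (\<phi> t s) * Re (\<phi> u s))"
        using ge[OF t] ge[OF u] m by (intro mult_left_mono mult_mono) auto
      finally show "(cmod (\<phi> t s - \<phi> u s))\<^sup>2 \<le> 4 * (C / 2 * \<bar>t - u\<bar>)\<^sup>2 * (Re (\<phi> t s) * Re (\<phi> u s))" .
    qed (use C in simp)
    then show ?thesis by (simp add: dist_norm)
  qed
  show "connected_component comp_ops (comp_op \<phi>0) (comp_op \<phi>1)"
    unfolding connected_component_def
  proof (intro exI conjI)
    have "(C / 2)-lipschitz_on {0..1} (\<lambda>t. comp_op (\<phi> t))"
      by (rule lipschitz_onI) (use lip C in auto)
    then show "connected ((\<lambda>t. comp_op (\<phi> t)) ` {0..1})"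
      by (intro connected_continuous_image lipschitz_on_continuous_on) auto
    show "(\<lambda>t. comp_op (\<phi> t)) ` {0..1} \<subseteq> comp_ops"
      unfolding comp_ops_def GH_class_def using gh\<phi> by blast
    show "comp_op \<phi>0 \<in> (\<lambda>t. comp_op (\<phi> t)) ` {0..1}"
      using ends(1) by (intro image_eqI[of _ _ 0]) auto
    show "comp_op \<phi>1 \<in> (\<lambda>t. comp_op (\<phi> t)) ` {0..1}"
      using ends(2) by (intro image_eqI[of _ _ 1]) auto
  qed
  assume asym: "\<forall>\<epsilon>>0. \<exists>\<theta>>0. \<forall>s\<in>half_plane 0. min (Re (\<phi>0 s)) (Re (\<phi>1 s)) < \<theta> \<longrightarrow>
         cmod (\<phi>0 s - \<phi>1 s) \<le> \<epsilon> * min (Re (\<phi>0 s)) (Re (\<phi>1 s)) \<and>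
         cmod (deriv \<phi>0 s - deriv \<phi>1 s) \<le> \<epsilon>"
  obtain \<rho>0 \<rho>1 where ad: "admissible c0 \<phi>0 \<rho>0" "admissible c0 \<phi>1 \<rho>1"
    using adm[of 0] adm[of 1] by (auto simp: ends)
  have "\<rho>0 s = \<psi>0 s" "\<rho>1 s = \<psi>1 s" if "s \<in> half_plane 0" for s
    using ad assms(6,7) that by (auto simp: admissible_def)
  then have bd: "cmod (\<rho>0 s) \<le> C" "cmod (\<rho>1 s) \<le> C" if "s \<in> half_plane 0" for s
    using assms(10,11) that by simp_all
  show "compact_operator (comp_op \<phi>0 - comp_op \<phi>1)"
  proof (rule compact_operatorI)
    fix e :: real assume e: "e > 0"
    then obtain \<theta> where \<theta>: "\<theta> > 0" "\<forall>s\<in>half_plane 0. min (Re (\<phi>0 s)) (Re (\<phi>1 s)) < \<theta> \<longrightarrow>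
         cmod (\<phi>0 s - \<phi>1 s) \<le> e * min (Re (\<phi>0 s)) (Re (\<phi>1 s)) \<and> cmod (deriv \<phi>0 s - deriv \<phi>1 s) \<le> e"
      using asym by blast
    show "\<exists>N. \<forall>f. (\<forall>n\<le>N. dcoeff f n = 0) \<longrightarrow> norm ((comp_op \<phi>0 - comp_op \<phi>1) f) \<le> e * norm f"
      by (rule comp_op_diff_tail[OF ad bd e \<theta>(1)]) (use \<theta>(2) in blast)+
  qed
qed

end
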